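(* Given $\tilde O\!\left(\min_{\tau>0}\left(n^{2+\tau}+n^{6-2\tau}\right)\frac{\beta^2}{\varepsilon^2}\right)$ i.i.d. samples from an Ising model $p$ on $n$ nodes in the high-temperature regime with no external field and all edge parameters of absolute value at most $\beta$, there exists a polynomial-time algorithm which distinguishes between the cases $p\in\mathcal{I}_n$ and $d_{\mathrm{SKL}}(p,\mathcal{I}_n)\ge\varepsilon$ with probability at least $2/3$.
   Context: An Ising model on vertex set $V$, $|V|=n$, is the distribution on $\{-1,1\}^V$ with $p(x)\propto\exp\big(\sum_{v}\theta_v x_v+\sum_{u\ne v}\theta_{uv}x_ux_v\big)$. "No external field" means $\theta_v=0$ for all $v$. High-temperature regime: $\max_{v}\sum_{u\ne v}\tanh(|\theta_{uv}|)\le1-\eta$ for some constant $\eta>0$. $\mathcal{I}_n$ is the set of product distributions on $\{-1,1\}^n$; $d_{\mathrm{SKL}}(p,q)=d_{\mathrm{KL}}(p\|q)+d_{\mathrm{KL}}(q\|p)$, $d_{\mathrm{SKL}}(p,\mathcal{I}_n)=\min_{q\in\mathcal{I}_n}d_{\mathrm{SKL}}(p,q)$. $\tilde O$ hides polylogarithmic factors. *)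

theory Defs
  imports "HOL-Probability.Probability"
begin

section \<open>Ising models and product distributions\<close>

text \<open>The vertex set is \<open>{..<n}\<close>. Coordinates outside of it carry the dummy value 0, the default
  value used for \<open>Pi_pmf\<close> below.\<close>

definition spin_configs :: "nat \<Rightarrow> (nat \<Rightarrow> real) set" where
  "spin_configs n = PiE_dflt {..<n} 0 (\<lambda>_. {-1, 1})"

text \<open>Every unordered pair of vertices contributes one term to the exponent. This is the convention
  for which \<open>high_temperature\<close> below is Dobrushin's uniqueness condition.\<close>

definition ising_weight :: "nat \<Rightarrow> (nat \<Rightarrow> real) \<Rightarrow> (nat \<Rightarrow> nat \<Rightarrow> real) \<Rightarrow> (nat \<Rightarrow> real) \<Rightarrow> real" where
  "ising_weight n h \<theta> x =
     exp ((\<Sum>v<n. h v * x v) + (\<Sum>v<n. \<Sum>u<v. \<theta> u v * x u * x v))"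

definition ising_pmf :: "nat \<Rightarrow> (nat \<Rightarrow> real) \<Rightarrow> (nat \<Rightarrow> nat \<Rightarrow> real) \<Rightarrow> (nat \<Rightarrow> real) pmf" where
  "ising_pmf n h \<theta> = embed_pmf (\<lambda>x. if x \<in> spin_configs n
     then ising_weight n h \<theta> x / (\<Sum>y\<in>spin_configs n. ising_weight n h \<theta> y) else 0)"

lemma finite_spin_configs [simp]: "finite (spin_configs n)"
  unfolding spin_configs_def by (intro finite_PiE_dflt) auto

lemma spin_configs_nonempty [simp]: "spin_configs n \<noteq> {}"
proof -
  have "(\<lambda>i. if i < n then 1 else 0) \<in> spin_configs n"
    by (auto simp: spin_configs_def PiE_dflt_def)
  thus ?thesis by blast
qed

lemma pmf_ising:
  "pmf (ising_pmf n h \<theta>) x = (if x \<in> spin_configs n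
     then ising_weight n h \<theta> x / (\<Sum>y\<in>spin_configs n. ising_weight n h \<theta> y) else 0)"
proof -
  let ?Z = "\<Sum>y\<in>spin_configs n. ising_weight n h \<theta> y"
  let ?f = "\<lambda>x. if x \<in> spin_configs n then ising_weight n h \<theta> x / ?Z else 0"
  have Z: "?Z > 0"
    by (intro sum_pos) (auto simp: ising_weight_def)
  have nn: "?f y \<ge> 0" for y
    using Z by (auto simp: ising_weight_def)
  have "(\<integral>\<^sup>+ y. ennreal (?f y) \<partial>count_space UNIV) = (\<Sum>y\<in>spin_configs n. ennreal (?f y))"
    by (intro nn_integral_count_space'[of "spin_configs n"]) auto
  also have "\<dots> = ennreal (\<Sum>y\<in>spin_configs n. ?f y)"
    by (intro sum_ennreal nn)
  also have "(\<Sum>y\<in>spin_configs n. ?f y) = 1"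
    using Z by (simp add: sum_divide_distrib[symmetric])
  finally have "(\<integral>\<^sup>+ y. ennreal (?f y) \<partial>count_space UNIV) = 1" by simp
  thus ?thesis
    unfolding ising_pmf_def by (subst pmf_embed_pmf) (use nn in auto)
qed

definition high_temperature :: "nat \<Rightarrow> real \<Rightarrow> (nat \<Rightarrow> nat \<Rightarrow> real) \<Rightarrow> bool" where
  "high_temperature n \<eta> \<theta> \<longleftrightarrow>
     (MAX v\<in>{..<n}. \<Sum>u\<in>{..<n} - {v}. tanh \<bar>\<theta> u v\<bar>) \<le> 1 - \<eta>"

definition product_pmfs :: "nat \<Rightarrow> (nat \<Rightarrow> real) pmf set" where
  "product_pmfs n = {Pi_pmf {..<n} 0 q | q. \<forall>v<n. set_pmf (q v) \<subseteq> {-1, 1}}"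

text \<open>\<open>KL_divergence\<close> takes the reference measure first, and its value is meaningless unless the second
  measure is absolutely continuous with respect to the first one.\<close>

definition kl_div :: "'a pmf \<Rightarrow> 'a pmf \<Rightarrow> ereal" where
  "kl_div p q = (if set_pmf p \<subseteq> set_pmf q
     then ereal (KL_divergence (exp 1) (measure_pmf q) (measure_pmf p)) else \<infinity>)"

lemma measure_pmf_eq_density:
  assumes "set_pmf p \<subseteq> set_pmf q"
  shows "measure_pmf p = density (measure_pmf q) (\<lambda>x. ennreal (pmf p x / pmf q x))"
proof -
  have "density (measure_pmf q) (\<lambda>x. ennreal (pmf p x / pmf q x)) =
    density (count_space UNIV) (\<lambda>x. ennreal (pmf q x) * ennreal (pmf p x / pmf q x))"
    by (subst measure_pmf_eq_density) (simp add: density_density_eq)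
  also have "(\<lambda>x. ennreal (pmf q x) * ennreal (pmf p x / pmf q x)) = (\<lambda>x. ennreal (pmf p x))"
  proof
    fix x
    have "pmf q x * (pmf p x / pmf q x) = pmf p x"
      using assms by (cases "pmf q x = 0") (auto simp: set_pmf_iff)
    thus "ennreal (pmf q x) * ennreal (pmf p x / pmf q x) = ennreal (pmf p x)"
      by (simp flip: ennreal_mult')
  qed
  finally show ?thesis by (simp add: measure_pmf_eq_density[of p])
qed

lemma kl_div_finite:
  assumes "finite (set_pmf q)" "set_pmf p \<subseteq> set_pmf q"
  shows "kl_div p q = ereal (\<Sum>x\<in>set_pmf p. pmf p x * ln (pmf p x / pmf q x))"
proof -
  have "KL_divergence (exp 1) (measure_pmf q) (measure_pmf p) =
    (\<integral>x. (pmf p x / pmf q x) * log (exp 1) (pmf p x / pmf q x) \<partial>measure_pmf q)"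
    by (subst measure_pmf_eq_density[OF assms(2)], rule sigma_finite_measure.KL_density)
       (auto intro: measure_pmf.sigma_finite_measure_axioms)
  also have "\<dots> = (\<Sum>x\<in>set_pmf q. (pmf p x / pmf q x) * ln (pmf p x / pmf q x) * pmf q x)"
    by (subst integral_measure_pmf_real[OF assms(1)]) (auto simp: log_def)
  also have "\<dots> = (\<Sum>x\<in>set_pmf q. pmf p x * ln (pmf p x / pmf q x))"
    by (intro sum.cong) (auto simp: set_pmf_iff)
  also have "\<dots> = (\<Sum>x\<in>set_pmf p. pmf p x * ln (pmf p x / pmf q x))"
    using assms by (intro sum.mono_neutral_right) (auto simp: set_pmf_iff)
  finally show ?thesis using assms(2) by (simp add: kl_div_def)
qed

definition skl_div :: "'a pmf \<Rightarrow> 'a pmf \<Rightarrow> ereal" where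
  "skl_div p q = kl_div p q + kl_div q p"

definition skl_dist :: "'a pmf \<Rightarrow> 'a pmf set \<Rightarrow> ereal" where
  "skl_dist p Q = (INF q\<in>Q. skl_div p q)"


section \<open>Sample size\<close>

text \<open>The infimum is a minimum: for \<open>n = 1\<close> the expression does not depend on \<open>\<tau>\<close>, and for \<open>n \<ge> 2\<close> it is
  minimal where \<open>n powr (3 * \<tau> - 4) = 2\<close>.\<close>

definition sample_rate :: "nat \<Rightarrow> real \<Rightarrow> real \<Rightarrow> real" where
  "sample_rate n \<beta> \<epsilon> =
     (INF \<tau>\<in>{0<..}. real n powr (2 + \<tau>) + real n powr (6 - 2 * \<tau>)) * (\<beta>\<^sup>2 / \<epsilon>\<^sup>2)"

text \<open>A sample size of the order \<open>g\<close> up to polylogarithmic factors: \<open>C * g * log^k g\<close>, with the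
  logarithm shifted so that it is bounded away from 0.\<close>

definition soft_O_size :: "real \<Rightarrow> nat \<Rightarrow> real \<Rightarrow> nat" where
  "soft_O_size C k g = nat \<lceil>C * g * ln (2 + g) ^ k\<rceil>"


section \<open>Algorithms\<close>

text \<open>
  Programs run on a random access machine with real registers, as the parameters \<open>\<beta>\<close> and \<open>\<epsilon>\<close> are real
  numbers. Every assignment and every test costs one unit. Arithmetic is limited to addition and
  subtraction, with integer constants: after \<open>t\<close> steps, all register contents are integer linear
  combinations of 1 and the inputs whose coefficients have \<open>O(t)\<close> bits. Hence, unlike with
  multiplication at unit cost, polynomially many steps on rational inputs amount to polynomial time on a
  Turing machine. Registers are addressed by integers; an address that is not an integer is rounded
  down.
\<close>

type_synonym memory = "int \<Rightarrow> real"

datatype expr = Num int | Mem expr | Plus expr expr | Minus expr expr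

fun eval_expr :: "expr \<Rightarrow> memory \<Rightarrow> real" where
  "eval_expr (Num k) s = of_int k"
| "eval_expr (Mem e) s = s \<lfloor>eval_expr e s\<rfloor>"
| "eval_expr (Plus e1 e2) s = eval_expr e1 s + eval_expr e2 s"
| "eval_expr (Minus e1 e2) s = eval_expr e1 s - eval_expr e2 s"

text \<open>\<open>Assign e1 e2\<close> stores the value of \<open>e2\<close> in the register with address \<open>e1\<close>. The tests of
  \<open>IfLess e1 e2\<close> and \<open>WhileLess e1 e2\<close> are \<open>e1 < e2\<close>.\<close>

datatype prog =
    Assign expr expr
  | Seq prog prog
  | IfLess expr expr prog prog
  | WhileLess expr expr prog

text \<open>\<open>exec c s t s'\<close>: started in memory \<open>s\<close>, program \<open>c\<close> halts after \<open>t\<close> steps in memory \<open>s'\<close>.\<close>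

inductive exec :: "prog \<Rightarrow> memory \<Rightarrow> nat \<Rightarrow> memory \<Rightarrow> bool" where
  assign: "exec (Assign e1 e2) s 1 (s(\<lfloor>eval_expr e1 s\<rfloor> := eval_expr e2 s))"
| seq: "exec c1 s t1 s1 \<Longrightarrow> exec c2 s1 t2 s2 \<Longrightarrow> exec (Seq c1 c2) s (t1 + t2) s2"
| if_true: "eval_expr e1 s < eval_expr e2 s \<Longrightarrow> exec c1 s t s' \<Longrightarrow>
    exec (IfLess e1 e2 c1 c2) s (Suc t) s'"
| if_false: "\<not> eval_expr e1 s < eval_expr e2 s \<Longrightarrow> exec c2 s t s' \<Longrightarrow>
    exec (IfLess e1 e2 c1 c2) s (Suc t) s'"
| while_false: "\<not> eval_expr e1 s < eval_expr e2 s \<Longrightarrow> exec (WhileLess e1 e2 c) s 1 s"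
| while_true: "eval_expr e1 s < eval_expr e2 s \<Longrightarrow> exec c s t1 s1 \<Longrightarrow>
    exec (WhileLess e1 e2 c) s1 t2 s2 \<Longrightarrow> exec (WhileLess e1 e2 c) s (Suc (t1 + t2)) s2"

inductive_cases exec_AssignE: "exec (Assign e1 e2) s t s'"
inductive_cases exec_SeqE: "exec (Seq c1 c2) s t s'"
inductive_cases exec_IfLessE: "exec (IfLess e1 e2 c1 c2) s t s'"
inductive_cases exec_WhileLessE: "exec (WhileLess e1 e2 c) s t s'"

lemma exec_deterministic:
  "exec c s t s' \<Longrightarrow> exec c s t' s'' \<Longrightarrow> t' = t \<and> s'' = s'"
proof (induction arbitrary: t' s'' rule: exec.induct)
  case assign thus ?case by (auto elim: exec_AssignE)
next
  case seq thus ?case by (blast elim: exec_SeqE)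
next
  case if_true thus ?case by (blast elim: exec_IfLessE)
next
  case if_false thus ?case by (blast elim: exec_IfLessE)
next
  case while_false
  from while_false.prems while_false.hyps show ?case by (auto elim: exec_WhileLessE)
next
  case while_true thus ?case by (blast elim: exec_WhileLessE)
qed

text \<open>The input consists of \<open>n\<close>, \<open>m\<close>, \<open>\<beta>\<close>, \<open>\<epsilon>\<close> and the \<open>m\<close> samples \<open>X 0, \<dots>, X (m - 1)\<close>, one after the
  other. The answer is read off from register 0.\<close>

definition input :: "nat \<Rightarrow> nat \<Rightarrow> real \<Rightarrow> real \<Rightarrow> (nat \<Rightarrow> nat \<Rightarrow> real) \<Rightarrow> memory" where
  "input n m \<beta> \<epsilon> X a =
     (if a = 0 then real n else if a = 1 then real m else if a = 2 then \<beta> else if a = 3 then \<epsilon>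
      else if 4 \<le> a \<and> a < 4 + int (m * n) then X (nat (a - 4) div n) (nat (a - 4) mod n)
      else 0)"

datatype verdict = Product | Far

definition answers :: "prog \<Rightarrow> memory \<Rightarrow> verdict \<Rightarrow> bool" where
  "answers c s b \<longleftrightarrow> (\<exists>t s'. exec c s t s' \<and> s' 0 = (case b of Product \<Rightarrow> 1 | Far \<Rightarrow> 0))"

definition polynomial_time :: "prog \<Rightarrow> bool" where
  "polynomial_time c \<longleftrightarrow> (\<exists>a d. \<forall>n m \<beta> \<epsilon> X.
     1 \<le> n \<longrightarrow> 0 \<le> \<beta> \<longrightarrow> 0 < \<epsilon> \<longrightarrow> (\<forall>i<m. X i \<in> spin_configs n) \<longrightarrow>
     (\<exists>t s'. exec c (input n m \<beta> \<epsilon> X) t s' \<and> t \<le> a * (n + m) ^ d))"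

text \<open>The probability, over \<open>m\<close> i.i.d. samples from \<open>p\<close>, of the given answer.\<close>

definition answer_prob ::
  "prog \<Rightarrow> nat \<Rightarrow> nat \<Rightarrow> real \<Rightarrow> real \<Rightarrow> (nat \<Rightarrow> real) pmf \<Rightarrow> verdict \<Rightarrow> real" where
  "answer_prob c n m \<beta> \<epsilon> p b =
     measure_pmf.prob (Pi_pmf {..<m} (\<lambda>_. 0) (\<lambda>_. p)) {X. answers c (input n m \<beta> \<epsilon> X) b}"

end

theory Submission
  imports Defs
begin

text \<open>
  The test is a U-statistic: it compares the sum of \<open>(x\<^sub>i \<bullet> x\<^sub>j)\<^sup>2 - n\<close> over all pairs of samples with \<open>4mn\<close>.
  Its mean is \<open>m(m - 1)/2\<close> times the squared norm \<open>s\<close> of the matrix of pair correlations. A product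
  measure without external field is uniform, so that \<open>s = 0\<close>. The symmetrised divergence from the uniform
  measure is the sum of \<open>\<theta>\<^sub>u\<^sub>v E[x\<^sub>u x\<^sub>v]\<close> over all edges, so by Cauchy-Schwarz \<open>s \<ge> 4\<epsilon>\<^sup>2/(\<beta>n)\<^sup>2\<close> in the far case.
  In the high-temperature regime the Poincare inequality holds with a constant that depends on \<open>\<eta>\<close> only;
  applied twice, it bounds the variance of a quadratic form by its squared coefficients, which controls
  both terms in the Hoeffding decomposition of the U-statistic. Already of the order \<open>n\<^sup>3\<beta>\<^sup>2/\<epsilon>\<^sup>2\<close> many samples
  suffice, which is below the given rate.
\<close>

section \<open>Spin configurations\<close>

text \<open>Dobrushin's condition controls oscillations, hence sup norms, whereas variances need a
  spectral gap in L2. The bridge is \<open>sweep\<close>, the sum of all \<open>n\<close>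
  single-site heat-bath updates: it multiplies the total oscillation by at most
  \<open>n - \<eta>\<close>, and as it is self-adjoint, the same rate holds in L2 for centred
  functions. The missing \<eta> is the Poincare constant.

  The threshold 4mn involves none of \<beta>, \<epsilon>, \<eta>; these enter only through the
  sample size, so one program serves all of them. This is possible because the product case consists
  of a single distribution, the uniform one, which satisfies Dobrushin's condition with constant 1
  and gives the statistic a standard deviation of at most 2mn.

  In the far case the mean is of order m^2 s and the noise, up to factors in \<eta>, of order
  m^(3/2) sqrt(s) + mn. Both noise terms and the threshold are dominated as soon as ms is a large
  multiple of n, and the lower bound on s turns this into the cubic sample size. The given rate is
  smallest near \<tau> = 4/3, where it is of order n^(10/3); so neither a logarithmic factor nor a
  choice of \<tau> is called for.\<close>

lemma spin_configs_iff:
  "x \<in> spin_configs n \<longleftrightarrow> (\<forall>v<n. x v = -1 \<or> x v = 1) \<and> (\<forall>v\<ge>n. x v = 0)"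
  by (auto simp: spin_configs_def PiE_dflt_def not_less)

lemma spin_configs_upd: "x \<in> spin_configs n \<Longrightarrow> v < n \<Longrightarrow> s = -1 \<or> s = 1 \<Longrightarrow> x(v := s) \<in> spin_configs n"
  by (auto simp: spin_configs_iff)

lemma spin_configs_uminus: "x \<in> spin_configs n \<Longrightarrow> (\<lambda>v. - x v) \<in> spin_configs n"
  by (auto simp: spin_configs_iff)

lemma sum_spin_uminus: "(\<Sum>x\<in>spin_configs n. F (\<lambda>v. - x v)) = sum F (spin_configs n)"
  by (rule sum.reindex_bij_witness[of _ "\<lambda>x v. - x v" "\<lambda>x v. - x v"]) (auto intro: spin_configs_uminus)

text \<open>Flipping the spin at \<open>v\<close> permutes the configurations, and \<open>x\<close>
  together with its flip is the pair on the right. Computations with conditional laws at one vertex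
  go through this pairing.\<close>

lemma sum_spin_split:
  assumes "v < n"
  shows "sum F (spin_configs n) = (\<Sum>x\<in>spin_configs n. F (x(v := 1)) + F (x(v := -1))) / (2 :: real)"
proof -
  let ?S = "spin_configs n"
  have "(\<Sum>x\<in>?S. F (x(v := - x v))) = sum F ?S"
    by (rule sum.reindex_bij_witness[of _ "\<lambda>x. x(v := - x v)" "\<lambda>x. x(v := - x v)"])
       (use assms in \<open>auto simp: spin_configs_iff\<close>)
  hence "2 * sum F ?S = (\<Sum>x\<in>?S. F x + F (x(v := - x v)))"
    by (simp add: sum.distrib)
  also have "\<dots> = (\<Sum>x\<in>?S. F (x(v := 1)) + F (x(v := -1)))"
  proof (rule sum.cong)
    fix x assume "x \<in> ?S"
    hence "x v = -1 \<or> x v = 1" using assms by (auto simp: spin_configs_iff)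
    thus "F x + F (x(v := - x v)) = F (x(v := 1)) + F (x(v := -1))"
      by (metis add.commute add.inverse_inverse fun_upd_triv)
  qed simp
  finally show ?thesis by simp
qed

section \<open>The Poincare inequality under Dobrushin's condition\<close>

text \<open>Log-convexity makes the ratios \<open>b (Suc k) / b k\<close> nondecreasing. A first
  ratio above \<open>r\<close> would therefore force geometric growth that eventually beats
  \<open>D * r ^ k\<close>, however large \<open>D\<close> is.\<close>

lemma log_convex_ratio_le:
  fixes b :: "nat \<Rightarrow> real"
  assumes nn: "\<And>k. b k \<ge> 0" and conv: "\<And>k. (b (Suc k))\<^sup>2 \<le> b k * b (Suc (Suc k))"
    and bound: "\<And>k. b k \<le> D * r ^ k" and r: "r \<ge> 0"
  shows "b 1 \<le> r * b 0"
proof (rule ccontr)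
  assume *: "\<not> b 1 \<le> r * b 0"
  have b0: "b 0 > 0"
    using conv[of 0] nn[of 0] * by (cases "b 0 = 0") auto
  define \<rho> where "\<rho> = b 1 / b 0"
  have \<rho>: "\<rho> > r" using * b0 by (simp add: \<rho>_def field_simps)
  hence \<rho>0: "\<rho> > 0" using r by simp
  have step: "b k > 0 \<and> b (Suc k) \<ge> \<rho> * b k" for k
  proof (induction k)
    case 0 show ?case using b0 by (simp add: \<rho>_def)
  next
    case (Suc k)
    have p: "b (Suc k) > 0" using Suc \<rho>0 by (meson less_le_trans mult_pos_pos)
    have "\<rho> * b k * b (Suc k) \<le> (b (Suc k))\<^sup>2"
      using Suc p by (simp add: power2_eq_square)
    also have "\<dots> \<le> b k * b (Suc (Suc k))" by (rule conv)
    finally have "b k * (\<rho> * b (Suc k)) \<le> b k * b (Suc (Suc k))" by (simp add: algebra_simps)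
    thus ?case using p Suc by simp
  qed
  have geo: "b k \<ge> \<rho> ^ k * b 0" for k
  proof (induction k)
    case (Suc k)
    have "\<rho> ^ Suc k * b 0 \<le> \<rho> * b k" using Suc \<rho>0 by (simp add: mult.assoc)
    thus ?case using step[of k] by linarith
  qed simp
  show False
  proof (cases "r = 0")
    case True thus ?thesis using bound[of 1] * nn[of 0] by simp
  next
    case False
    hence r: "r > 0" using r by simp
    hence "1 < \<rho> / r" using \<rho> by simp
    then obtain k where k: "D / b 0 < (\<rho> / r) ^ k" using real_arch_pow by blast
    have "\<rho> ^ k * b 0 \<le> D * r ^ k" using geo[of k] bound[of k] by linarith
    hence "(\<rho> / r) ^ k \<le> D / b 0" using r b0 by (simp add: field_simps)
    thus False using k by simp
  qed
qed

section \<open>Means and heat-bath updates for a positive measure on spins\<close>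

locale spin_measure =
  fixes n :: nat and p :: "(nat \<Rightarrow> real) \<Rightarrow> real"
  assumes pos: "\<And>x. x \<in> spin_configs n \<Longrightarrow> p x > 0"
    and total: "sum p (spin_configs n) = 1"
begin

definition mean :: "((nat \<Rightarrow> real) \<Rightarrow> real) \<Rightarrow> real" where
  "mean f = (\<Sum>x\<in>spin_configs n. p x * f x)"

text \<open>The conditional probability of spin 1 at \<open>v\<close> given all other spins; it does
  not depend on \<open>x v\<close>.\<close>

definition cond_up :: "nat \<Rightarrow> (nat \<Rightarrow> real) \<Rightarrow> real" where
  "cond_up v x = p (x(v := 1)) / (p (x(v := 1)) + p (x(v := -1)))"

text \<open>The heat-bath update: conditional expectation of \<open>f\<close> given all spins except
  the one at \<open>v\<close>.\<close>

definition resample :: "nat \<Rightarrow> ((nat \<Rightarrow> real) \<Rightarrow> real) \<Rightarrow> (nat \<Rightarrow> real) \<Rightarrow> real" where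
  "resample v f x = cond_up v x * f (x(v := 1)) + (1 - cond_up v x) * f (x(v := -1))"

lemma mean_cong: "(\<And>x. x \<in> spin_configs n \<Longrightarrow> f x = g x) \<Longrightarrow> mean f = mean g"
  by (simp add: mean_def cong: sum.cong)

lemma mean_mono: "(\<And>x. x \<in> spin_configs n \<Longrightarrow> f x \<le> g x) \<Longrightarrow> mean f \<le> mean g"
  unfolding mean_def by (intro sum_mono mult_left_mono) (auto intro: less_imp_le pos)

lemma mean_const [simp]: "mean (\<lambda>_. k) = k"
  by (simp add: mean_def total flip: sum_distrib_right)

lemma mean_add: "mean (\<lambda>x. f x + g x) = mean f + mean g"
  by (simp add: mean_def algebra_simps sum.distrib)

lemma mean_diff: "mean (\<lambda>x. f x - g x) = mean f - mean g"
  by (simp add: mean_def algebra_simps sum_subtractf)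

lemma mean_cmult: "mean (\<lambda>x. k * f x) = k * mean f"
  by (simp add: mean_def sum_distrib_left algebra_simps)

lemma mean_sum: "mean (\<lambda>x. \<Sum>i\<in>I. f i x) = (\<Sum>i\<in>I. mean (f i))"
  unfolding mean_def by (simp add: sum_distrib_left) (rule sum.swap)

lemma mean_nonneg: "(\<And>x. x \<in> spin_configs n \<Longrightarrow> f x \<ge> 0) \<Longrightarrow> mean f \<ge> 0"
  using mean_mono[of "\<lambda>_. 0" f] by simp

lemma mean_Cauchy_Schwarz: "(mean (\<lambda>x. f x * g x))\<^sup>2 \<le> mean (\<lambda>x. (f x)\<^sup>2) * mean (\<lambda>x. (g x)\<^sup>2)"
proof -
  let ?S = "spin_configs n"
  have "(\<Sum>x\<in>?S. (sqrt (p x) * f x) * (sqrt (p x) * g x))\<^sup>2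
      \<le> (\<Sum>x\<in>?S. (sqrt (p x) * f x)\<^sup>2) * (\<Sum>x\<in>?S. (sqrt (p x) * g x)\<^sup>2)"
    by (rule Cauchy_Schwarz_ineq_sum)
  moreover have "(\<Sum>x\<in>?S. (sqrt (p x) * f x) * (sqrt (p x) * g x)) = mean (\<lambda>x. f x * g x)"
    unfolding mean_def by (rule sum.cong) (use pos in \<open>auto simp: less_imp_le algebra_simps\<close>)
  moreover have "(\<Sum>x\<in>?S. (sqrt (p x) * f x)\<^sup>2) = mean (\<lambda>x. (f x)\<^sup>2)" for f
    unfolding mean_def by (rule sum.cong) (use pos in \<open>auto simp: less_imp_le power_mult_distrib\<close>)
  ultimately show ?thesis by simp
qed

context
  fixes v assumes v: "v < n"
begin

lemma pos_upd: "x \<in> spin_configs n \<Longrightarrow> p (x(v := 1)) > 0" "x \<in> spin_configs n \<Longrightarrow> p (x(v := -1)) > 0"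
  using v by (auto intro: pos spin_configs_upd)

lemma cond_up_bounds: "x \<in> spin_configs n \<Longrightarrow> 0 \<le> cond_up v x" "x \<in> spin_configs n \<Longrightarrow> cond_up v x \<le> 1"
  using pos_upd[of x] by (auto simp: cond_up_def)

lemma mean_split:
  "mean f = (\<Sum>x\<in>spin_configs n. p (x(v := 1)) * f (x(v := 1)) + p (x(v := -1)) * f (x(v := -1))) / 2"
  unfolding mean_def by (rule sum_spin_split[OF v])

lemma weighted_resample:
  assumes "x \<in> spin_configs n"
  shows "(p (x(v := 1)) + p (x(v := -1))) * resample v f x =
    p (x(v := 1)) * f (x(v := 1)) + p (x(v := -1)) * f (x(v := -1))"
proof -
  let ?W = "p (x(v := 1)) + p (x(v := -1))"
  have W: "?W * cond_up v x = p (x(v := 1))" using pos_upd[OF assms] by (simp add: cond_up_def)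
  have "?W * resample v f x = (?W * cond_up v x) * f (x(v := 1)) + (?W - ?W * cond_up v x) * f (x(v := -1))"
    by (simp add: resample_def algebra_simps)
  thus ?thesis by (simp only: W) simp
qed

text \<open>\<open>resample v f\<close> agrees on both members of a pair and factors out, leaving
  the weight of the pair times \<open>resample v g\<close>. The result is symmetric in
  \<open>f\<close> and \<open>g\<close>, whence self-adjointness; for \<open>g = f\<close> it is the
  squared norm of the projection.\<close>

lemma mean_resample_mult:
  "mean (\<lambda>x. resample v f x * g x) =
     (\<Sum>x\<in>spin_configs n. (p (x(v := 1)) + p (x(v := -1))) * resample v f x * resample v g x) / 2"
proof -
  have [simp]: "resample v f (x(v := s)) = resample v f x" for x s
    by (simp add: resample_def cond_up_def)
  show ?thesis
    unfolding mean_split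
  proof (intro arg_cong[of _ _ "\<lambda>s. s / 2"] sum.cong refl)
    fix x assume "x \<in> spin_configs n"
    from weighted_resample[OF this, of g]
    show "p (x(v := 1)) * (resample v f (x(v := 1)) * g (x(v := 1)))
        + p (x(v := -1)) * (resample v f (x(v := -1)) * g (x(v := -1))) =
      (p (x(v := 1)) + p (x(v := -1))) * resample v f x * resample v g x"
      by (simp add: mult.assoc mult.left_commute[of _ "resample v f x"] flip: distrib_left)
  qed
qed

end

lemma resample_self_adjoint:
  "v < n \<Longrightarrow> mean (\<lambda>x. resample v f x * g x) = mean (\<lambda>x. f x * resample v g x)"
  using mean_resample_mult[of v f g] mean_resample_mult[of v g f] by (simp add: mult.commute mult.left_commute)

lemma mean_resample: "v < n \<Longrightarrow> mean (resample v f) = mean f"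
  using resample_self_adjoint[of v f "\<lambda>_. 1"] by (simp add: resample_def[abs_def])

text \<open>The left-hand side is the mean conditional variance of \<open>f\<close> at
  \<open>v\<close>. Given the other spins, \<open>f\<close> takes only two values, and a two-valued
  variable has variance at most a quarter of their squared difference.\<close>

lemma resample_defect:
  assumes v: "v < n"
  shows "mean (\<lambda>x. (f x)\<^sup>2) - mean (\<lambda>x. f x * resample v f x) \<le>
    mean (\<lambda>x. (f (x(v := 1)) - f (x(v := -1)))\<^sup>2) / 4"
proof -
  let ?W = "\<lambda>x. p (x(v := 1)) + p (x(v := -1))"
  have "mean (\<lambda>x. (f x)\<^sup>2) - mean (\<lambda>x. f x * resample v f x) =
     (\<Sum>x\<in>spin_configs n. p (x(v := 1)) * (f (x(v := 1)))\<^sup>2 + p (x(v := -1)) * (f (x(v := -1)))\<^sup>2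
        - ?W x * (resample v f x)\<^sup>2) / 2"
    unfolding resample_self_adjoint[OF v, symmetric] mean_resample_mult[OF v]
    by (subst mean_split[OF v]) (simp add: sum_subtractf power2_eq_square algebra_simps diff_divide_distrib)
  also have "\<dots> \<le> (\<Sum>x\<in>spin_configs n. ?W x * ((f (x(v := 1)) - f (x(v := -1)))\<^sup>2 / 4)) / 2"
  proof (intro divide_right_mono sum_mono)
    fix x assume x: "x \<in> spin_configs n"
    define q a b where "q = cond_up v x" and "a = f (x(v := 1))" and "b = f (x(v := -1))"
    have W: "?W x > 0" using pos_upd[OF v x] by simp
    have p1: "p (x(v := 1)) = ?W x * q" using W by (simp add: q_def cond_up_def)
    hence p2: "p (x(v := -1)) = ?W x * (1 - q)" by (simp add: algebra_simps)
    \<comment> \<open>The two-point variance is \<open>q * (1 - q)\<close> times the squared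
      difference, and \<open>q * (1 - q)\<close> is 1/4 minus a square.\<close>
    have "q * a\<^sup>2 + (1 - q) * b\<^sup>2 - (q * a + (1 - q) * b)\<^sup>2 = (a - b)\<^sup>2 / 4 - (q - 1/2)\<^sup>2 * (a - b)\<^sup>2"
      by (simp add: power2_eq_square field_simps)
    also have "\<dots> \<le> (a - b)\<^sup>2 / 4" by simp
    finally have "?W x * (q * a\<^sup>2 + (1 - q) * b\<^sup>2 - (q * a + (1 - q) * b)\<^sup>2) \<le> ?W x * ((a - b)\<^sup>2 / 4)"
      using W by (intro mult_left_mono) auto
    moreover have "p (x(v := 1)) * a\<^sup>2 + p (x(v := -1)) * b\<^sup>2 - ?W x * (resample v f x)\<^sup>2 =
      ?W x * (q * a\<^sup>2 + (1 - q) * b\<^sup>2 - (q * a + (1 - q) * b)\<^sup>2)"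
    proof -
      have "p (x(v := 1)) * a\<^sup>2 = ?W x * (q * a\<^sup>2)" "p (x(v := -1)) * b\<^sup>2 = ?W x * ((1 - q) * b\<^sup>2)"
        by (metis p1 mult.assoc) (metis p2 mult.assoc)
      moreover have "resample v f x = q * a + (1 - q) * b" by (simp add: resample_def q_def a_def b_def)
      ultimately show ?thesis by (simp only: right_diff_distrib[of "?W x"] distrib_left[of "?W x"])
    qed
    ultimately show "p (x(v := 1)) * (f (x(v := 1)))\<^sup>2 + p (x(v := -1)) * (f (x(v := -1)))\<^sup>2
        - ?W x * (resample v f x)\<^sup>2 \<le> ?W x * ((f (x(v := 1)) - f (x(v := -1)))\<^sup>2 / 4)"
      by (simp add: a_def b_def)
  qed simp
  also have "\<dots> = mean (\<lambda>x. (f (x(v := 1)) - f (x(v := -1)))\<^sup>2 / 4)"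
    by (subst mean_split[OF v]) (simp add: distrib_right add_divide_distrib)
  also have "\<dots> = mean (\<lambda>x. (f (x(v := 1)) - f (x(v := -1)))\<^sup>2) / 4"
    using mean_cmult[of "1/4"] by simp
  finally show ?thesis .
qed

section \<open>Oscillations in single coordinates\<close>

definition osc_bound :: "(nat \<Rightarrow> real) \<Rightarrow> ((nat \<Rightarrow> real) \<Rightarrow> real) \<Rightarrow> bool" where
  "osc_bound d f \<longleftrightarrow> (\<forall>u<n. 0 \<le> d u \<and> (\<forall>x\<in>spin_configs n. \<bar>f (x(u := 1)) - f (x(u := -1))\<bar> \<le> d u))"

lemma osc_bound_exists: "\<exists>d. osc_bound d f"
  by (intro exI[of _ "\<lambda>u. \<Sum>x\<in>spin_configs n. \<bar>f (x(u := 1)) - f (x(u := -1))\<bar>"])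
     (auto simp: osc_bound_def intro!: sum_nonneg member_le_sum)

lemma osc_bound_diff:
  assumes d: "osc_bound d f" and x: "x \<in> spin_configs n" and y: "y \<in> spin_configs n"
  shows "\<bar>f x - f y\<bar> \<le> sum d {..<n}"
proof -
  \<comment> \<open>Hybrid configurations: \<open>z k\<close> has moved from \<open>x\<close> to
    \<open>y\<close> on the first \<open>k\<close> vertices, so consecutive ones differ in at most
    one spin.\<close>
  define z where "z k = (\<lambda>u. if u < k then y u else x u)" for k
  have "\<bar>f x - f (z k)\<bar> \<le> sum d {..<k}" if "k \<le> n" for k
    using that
  proof (induction k)
    case 0 show ?case by (simp add: z_def)
  next
    case (Suc k)
    have zk: "z k \<in> spin_configs n" "z (Suc k) = (z k)(k := y k)" "z k k = x k"
      using x y by (auto simp: z_def spin_configs_iff less_Suc_eq)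
    have xy: "x k = -1 \<or> x k = 1" "y k = -1 \<or> y k = 1" using x y Suc.prems by (auto simp: spin_configs_iff)
    have dk: "\<bar>f ((z k)(k := 1)) - f ((z k)(k := -1))\<bar> \<le> d k" "0 \<le> d k"
      using d zk Suc.prems by (auto simp: osc_bound_def)
    have "\<bar>f (z k) - f (z (Suc k))\<bar> \<le> d k"
    proof (cases "x k = y k")
      case True
      hence "z (Suc k) = z k" using zk by (metis fun_upd_triv)
      thus ?thesis using dk by simp
    next
      case False
      have "z k = (z k)(k := x k)" using zk by (metis fun_upd_triv)
      thus ?thesis using dk xy False zk(2) by (metis abs_minus_commute)
    qed
    thus ?case using Suc by simp
  qed
  moreover have "z n = y" using x y by (auto simp: z_def spin_configs_iff not_less)
  ultimately show ?thesis by auto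
qed

text \<open>A function of mean 0 is at each point the average of the differences
  \<open>f x - f y\<close>, so its oscillations bound its values as well.\<close>

lemma osc_bound_centered:
  assumes d: "osc_bound d f" and m: "mean f = 0" and x: "x \<in> spin_configs n"
  shows "\<bar>f x\<bar> \<le> sum d {..<n}"
proof -
  have "f x = mean (\<lambda>y. f x - f y)" using m by (simp add: mean_diff)
  moreover have "mean (\<lambda>y. f x - f y) \<le> mean (\<lambda>y. sum d {..<n})"
    using osc_bound_diff[OF d x] by (intro mean_mono) (auto simp: abs_le_iff)
  moreover have "mean (\<lambda>y. - sum d {..<n}) \<le> mean (\<lambda>y. f x - f y)"
    using osc_bound_diff[OF d x] by (intro mean_mono) (fastforce simp: abs_le_iff)
  ultimately show ?thesis by simp
qed

end

section \<open>Contraction and spectral gap of the heat-bath dynamics\<close>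

locale dobrushin = spin_measure +
  fixes c :: "nat \<Rightarrow> nat \<Rightarrow> real" and \<eta> :: real
  assumes influence: "\<And>u v x. u < n \<Longrightarrow> v < n \<Longrightarrow> u \<noteq> v \<Longrightarrow> x \<in> spin_configs n \<Longrightarrow>
      \<bar>cond_up v (x(u := 1)) - cond_up v (x(u := -1))\<bar> \<le> c u v"
    and influence_sum: "\<And>v. v < n \<Longrightarrow> (\<Sum>u\<in>{..<n} - {v}. c u v) \<le> 1 - \<eta>"
    and n_pos: "0 < n" and \<eta>_pos: "0 < \<eta>"
begin

text \<open>Up to the factor \<open>n\<close>, the transition operator of the Glauber dynamics that
  updates a uniformly chosen vertex.\<close>

definition sweep :: "((nat \<Rightarrow> real) \<Rightarrow> real) \<Rightarrow> (nat \<Rightarrow> real) \<Rightarrow> real" where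
  "sweep f x = (\<Sum>v<n. resample v f x)"

lemma influence_nonneg: "u < n \<Longrightarrow> v < n \<Longrightarrow> u \<noteq> v \<Longrightarrow> 0 \<le> c u v"
  using influence[of u v] spin_configs_nonempty[of n] by (meson abs_ge_zero equals0I order_trans)

lemma \<eta>_le_1: "\<eta> \<le> 1"
  using influence_sum[OF n_pos] sum_nonneg[of "{..<n} - {0}" "\<lambda>u. c u 0"] influence_nonneg n_pos by force

text \<open>Flipping \<open>u\<close> acts in two ways: it changes the two averaged values of
  \<open>f\<close> by at most \<open>d u\<close>, and it shifts the law of the new spin at
  \<open>v\<close> by at most \<open>c u v\<close>, which matters only as far as \<open>f\<close>
  depends on that spin.\<close>

lemma resample_osc:
  assumes d: "osc_bound d f" and u: "u < n" and v: "v < n" and uv: "u \<noteq> v" and x: "x \<in> spin_configs n"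
  shows "\<bar>resample v f (x(u := 1)) - resample v f (x(u := -1))\<bar> \<le> d u + c u v * d v"
proof -
  define q q' where "q = cond_up v (x(u := 1))" and "q' = cond_up v (x(u := -1))"
  define a b a' b' where "a = f (x(u := 1, v := 1))" and "b = f (x(u := 1, v := -1))"
    and "a' = f (x(u := -1, v := 1))" and "b' = f (x(u := -1, v := -1))"
  have xu: "x(u := 1) \<in> spin_configs n" "x(u := -1) \<in> spin_configs n"
    and xv: "x(v := 1) \<in> spin_configs n" "x(v := -1) \<in> spin_configs n"
    using u v x by (auto intro: spin_configs_upd)
  have q: "0 \<le> q" "q \<le> 1" using cond_up_bounds[OF v xu(1)] by (auto simp: q_def)
  have qq: "\<bar>q - q'\<bar> \<le> c u v" using influence[OF u v uv x] by (simp add: q_def q'_def)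
  have "\<bar>a - a'\<bar> \<le> d u" "\<bar>b - b'\<bar> \<le> d u"
    using d u xv uv by (auto simp: osc_bound_def a_def a'_def b_def b'_def fun_upd_twist[of u v])
  hence 1: "\<bar>q * (a - a')\<bar> \<le> q * d u" "\<bar>(1 - q) * (b - b')\<bar> \<le> (1 - q) * d u"
    using q by (auto simp: abs_mult intro: mult_left_mono)
  have "\<bar>a' - b'\<bar> \<le> d v" using d v xu(2) by (auto simp: osc_bound_def a'_def b'_def)
  hence 2: "\<bar>(q - q') * (a' - b')\<bar> \<le> c u v * d v"
    using qq by (auto simp: abs_mult intro!: mult_mono)
  have "resample v f (x(u := 1)) - resample v f (x(u := -1)) =
     q * (a - a') + (1 - q) * (b - b') + (q - q') * (a' - b')"
    by (simp add: resample_def q_def q'_def a_def b_def a'_def b'_def algebra_simps)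
  hence "\<bar>resample v f (x(u := 1)) - resample v f (x(u := -1))\<bar> \<le> q * d u + (1 - q) * d u + c u v * d v"
    using 1 2 by linarith
  thus ?thesis by (simp add: algebra_simps)
qed

lemma sweep_osc:
  assumes d: "osc_bound d f"
  shows "\<exists>d'. osc_bound d' (sweep f) \<and> sum d' {..<n} \<le> (real n - \<eta>) * sum d {..<n}"
proof -
  \<comment> \<open>The update at \<open>u\<close> itself forgets the old spin there, so
    \<open>v = u\<close> contributes no oscillation. This omission is the source of the
    contraction.\<close>
  define d' where "d' u = (\<Sum>v\<in>{..<n} - {u}. d u + c u v * d v)" for u
  have d0: "d u \<ge> 0" if "u < n" for u using d that by (auto simp: osc_bound_def)
  have "osc_bound d' (sweep f)"
    unfolding osc_bound_def
  proof (intro allI impI conjI ballI)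
    fix u assume u: "u < n"
    show "0 \<le> d' u"
      unfolding d'_def by (intro sum_nonneg add_nonneg_nonneg mult_nonneg_nonneg) (auto simp: d0 u influence_nonneg)
    fix x assume x: "x \<in> spin_configs n"
    have "sweep f (x(u := 1)) - sweep f (x(u := -1)) =
       (\<Sum>v<n. resample v f (x(u := 1)) - resample v f (x(u := -1)))"
      by (simp add: sweep_def sum_subtractf)
    also have "\<dots> = (\<Sum>v\<in>{..<n} - {u}. resample v f (x(u := 1)) - resample v f (x(u := -1)))"
      using u by (subst sum.remove[of _ u]) (auto simp: resample_def cond_up_def)
    finally have "\<bar>sweep f (x(u := 1)) - sweep f (x(u := -1))\<bar> \<le>
        (\<Sum>v\<in>{..<n} - {u}. \<bar>resample v f (x(u := 1)) - resample v f (x(u := -1))\<bar>)" by simp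
    also have "\<dots> \<le> d' u"
      unfolding d'_def by (intro sum_mono resample_osc[OF d]) (use u x in auto)
    finally show "\<bar>sweep f (x(u := 1)) - sweep f (x(u := -1))\<bar> \<le> d' u" .
  qed
  moreover have "sum d' {..<n} \<le> (real n - \<eta>) * sum d {..<n}"
  proof -
    have "sum d' {..<n} = (\<Sum>u<n. (real n - 1) * d u + (\<Sum>v\<in>{..<n} - {u}. c u v * d v))"
      unfolding d'_def using n_pos by (intro sum.cong) (auto simp: sum.distrib of_nat_diff algebra_simps)
    also have "\<dots> = (real n - 1) * sum d {..<n} + (\<Sum>u<n. \<Sum>v\<in>{..<n} - {u}. c u v * d v)"
      by (simp add: sum.distrib sum_distrib_left)
    \<comment> \<open>\<open>influence_sum\<close> runs over the influencing vertex \<open>u\<close>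
      for a fixed \<open>v\<close>, so \<open>u\<close> has to become the inner index.\<close>
    also have "(\<Sum>u<n. \<Sum>v\<in>{..<n} - {u}. c u v * d v) = (\<Sum>v<n. \<Sum>u\<in>{..<n} - {v}. c u v * d v)"
    proof -
      have "{v. v < n \<and> u \<noteq> v} = {..<n} - {u}" "{v. v < n \<and> v \<noteq> u} = {..<n} - {u}" for u by auto
      thus ?thesis
        using sum.swap_restrict[of "{..<n}" "{..<n}" "\<lambda>u v. c u v * d v" "(\<noteq>)"] by simp
    qed
    also have "\<dots> = (\<Sum>v<n. (\<Sum>u\<in>{..<n} - {v}. c u v) * d v)"
      by (simp add: sum_distrib_right)
    also have "\<dots> \<le> (\<Sum>v<n. (1 - \<eta>) * d v)"
      by (intro sum_mono mult_right_mono influence_sum d0) auto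
    also have "\<dots> = (1 - \<eta>) * sum d {..<n}" by (rule sum_distrib_left[symmetric])
    finally show ?thesis by (simp add: algebra_simps)
  qed
  ultimately show ?thesis by blast
qed

lemma mean_sweep: "mean (sweep f) = real n * mean f"
  unfolding sweep_def mean_sum by (simp add: mean_resample)

lemma sweep_self_adjoint: "mean (\<lambda>x. sweep f x * g x) = mean (\<lambda>x. f x * sweep g x)"
  unfolding sweep_def sum_distrib_left sum_distrib_right mean_sum by (simp add: resample_self_adjoint)

text \<open>The oscillation bound only gives the decay rate of \<open>sweep ^^ k\<close> up to a constant depending on \<open>f\<close>.
  Self-adjointness makes the squared norms log-convex in \<open>k\<close>, so that the rate holds from the first step on.\<close>

lemma sweep_contraction:
  assumes "mean f = 0"
  shows "mean (\<lambda>x. (sweep f x)\<^sup>2) \<le> (real n - \<eta>)\<^sup>2 * mean (\<lambda>x. (f x)\<^sup>2)"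
proof -
  define b where "b k = mean (\<lambda>x. ((sweep ^^ k) f x)\<^sup>2)" for k
  obtain d where d: "osc_bound d f" using osc_bound_exists by blast
  have r: "real n - \<eta> \<ge> 0" using \<eta>_le_1 n_pos by linarith
  have "\<exists>d'. osc_bound d' ((sweep ^^ k) f) \<and> sum d' {..<n} \<le> (real n - \<eta>) ^ k * sum d {..<n}" for k
  proof (induction k)
    case 0 thus ?case using d by auto
  next
    case (Suc k)
    then obtain d' where d': "osc_bound d' ((sweep ^^ k) f)" "sum d' {..<n} \<le> (real n - \<eta>) ^ k * sum d {..<n}"
      by blast
    obtain d'' where d'': "osc_bound d'' (sweep ((sweep ^^ k) f))" "sum d'' {..<n} \<le> (real n - \<eta>) * sum d' {..<n}"
      using sweep_osc[OF d'(1)] by blast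
    have "sum d'' {..<n} \<le> (real n - \<eta>) * ((real n - \<eta>) ^ k * sum d {..<n})"
      using d''(2) mult_left_mono[OF d'(2) r] by linarith
    thus ?case using d''(1) by (auto simp: mult.assoc)
  qed
  note osc = this
  have m0: "mean ((sweep ^^ k) f) = 0" for k
    by (induction k) (auto simp: assms mean_sweep)
  have "b 1 \<le> (real n - \<eta>)\<^sup>2 * b 0"
  proof (rule log_convex_ratio_le)
    show "b k \<ge> 0" for k unfolding b_def by (intro mean_nonneg) auto
    show "(b (Suc k))\<^sup>2 \<le> b k * b (Suc (Suc k))" for k
    proof -
      have "b (Suc k) = mean (\<lambda>x. (sweep ^^ k) f x * (sweep ^^ Suc (Suc k)) f x)"
        using sweep_self_adjoint[of "(sweep ^^ k) f" "(sweep ^^ Suc k) f"]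
        by (simp add: b_def power2_eq_square)
      thus ?thesis
        using mean_Cauchy_Schwarz[of "(sweep ^^ k) f" "(sweep ^^ Suc (Suc k)) f"]
        by (simp only: b_def[of k] b_def[of "Suc (Suc k)"])
    qed
    show "b k \<le> (sum d {..<n})\<^sup>2 * ((real n - \<eta>)\<^sup>2) ^ k" for k
    proof -
      obtain d' where d': "osc_bound d' ((sweep ^^ k) f)" "sum d' {..<n} \<le> (real n - \<eta>) ^ k * sum d {..<n}"
        using osc by blast
      have "b k \<le> mean (\<lambda>_. ((real n - \<eta>) ^ k * sum d {..<n})\<^sup>2)"
        unfolding b_def
      proof (rule mean_mono)
        fix x assume "x \<in> spin_configs n"
        hence "\<bar>(sweep ^^ k) f x\<bar> \<le> (real n - \<eta>) ^ k * sum d {..<n}"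
          using osc_bound_centered[OF d'(1) m0] d'(2) by force
        thus "((sweep ^^ k) f x)\<^sup>2 \<le> ((real n - \<eta>) ^ k * sum d {..<n})\<^sup>2"
          by (metis abs_ge_zero power2_abs power_mono)
      qed
      thus ?thesis by (simp add: power_mult_distrib mult.commute power_mult[symmetric])
    qed
  qed simp
  thus ?thesis by (simp add: b_def)
qed

text \<open>Summed over all vertices, the defects of \<open>resample_defect\<close> give
  \<open>n\<close> times the squared norm of \<open>f\<close> minus its inner product with
  \<open>sweep f\<close>. By contraction and Cauchy-Schwarz that product is at most
  \<open>n - \<eta>\<close> times the squared norm, so \<eta> times it is left.\<close>

lemma poincare_centered:
  assumes "mean f = 0"
  shows "\<eta> * mean (\<lambda>x. (f x)\<^sup>2) \<le> (\<Sum>v<n. mean (\<lambda>x. (f (x(v := 1)) - f (x(v := -1)))\<^sup>2)) / 4"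
proof -
  let ?N = "mean (\<lambda>x. (f x)\<^sup>2)"
  have N: "?N \<ge> 0" by (intro mean_nonneg) auto
  have r: "real n - \<eta> \<ge> 0" using \<eta>_le_1 n_pos by linarith
  have "(mean (\<lambda>x. f x * sweep f x))\<^sup>2 \<le> ?N * mean (\<lambda>x. (sweep f x)\<^sup>2)"
    by (rule mean_Cauchy_Schwarz)
  also have "\<dots> \<le> ?N * ((real n - \<eta>)\<^sup>2 * ?N)"
    by (intro mult_left_mono sweep_contraction assms N)
  also have "\<dots> = ((real n - \<eta>) * ?N)\<^sup>2" by (simp add: power2_eq_square)
  finally have 1: "mean (\<lambda>x. f x * sweep f x) \<le> (real n - \<eta>) * ?N"
    using r N by (rule power2_le_imp_le[OF _ mult_nonneg_nonneg])
  have "mean (\<lambda>x. f x * sweep f x) = (\<Sum>v<n. mean (\<lambda>x. f x * resample v f x))"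
    by (simp add: sweep_def sum_distrib_left mean_sum)
  hence "real n * ?N - mean (\<lambda>x. f x * sweep f x) = (\<Sum>v<n. ?N - mean (\<lambda>x. f x * resample v f x))"
    by (simp add: sum_subtractf)
  also have "\<dots> \<le> (\<Sum>v<n. mean (\<lambda>x. (f (x(v := 1)) - f (x(v := -1)))\<^sup>2) / 4)"
    by (intro sum_mono resample_defect) auto
  finally show ?thesis using 1 by (simp add: algebra_simps sum_divide_distrib)
qed

lemma poincare:
  "\<eta> * mean (\<lambda>x. (f x - mean f)\<^sup>2) \<le> (\<Sum>v<n. mean (\<lambda>x. (f (x(v := 1)) - f (x(v := -1)))\<^sup>2)) / 4"
  using poincare_centered[of "\<lambda>x. f x - mean f"] by (simp add: mean_diff)

end

section \<open>Ising models without external field\<close>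

lemma sum_symmetric_pairs:
  fixes g :: "nat \<Rightarrow> nat \<Rightarrow> real"
  assumes "\<And>u v. u < n \<Longrightarrow> v < n \<Longrightarrow> g u v = g v u" and "\<And>u. u < n \<Longrightarrow> g u u = 0"
  shows "(\<Sum>u<n. \<Sum>v<n. g u v) = 2 * (\<Sum>v<n. \<Sum>u<v. g u v)"
  using assms
proof (induction n)
  case (Suc n)
  have "(\<Sum>v<n. g n v) = (\<Sum>v<n. g v n)" by (intro sum.cong) (auto simp: Suc.prems)
  thus ?case using Suc by (simp add: sum.distrib)
qed simp

text \<open>By the addition formula the difference is 2b(1 - a^2)/(1 - a^2 b^2) with
  \<open>a = tanh r\<close> and \<open>b = tanh t\<close>, and the fraction without 2b is at most 1.
  Half of this difference is the effect of one neighbour on a conditional probability.\<close>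

lemma abs_tanh_diff_le:
  fixes r t :: real
  shows "\<bar>tanh (r + t) - tanh (r - t)\<bar> \<le> 2 * tanh \<bar>t\<bar>"
proof -
  define a b where "a = tanh r" and "b = tanh t"
  have ab: "\<bar>a\<bar> < 1" "\<bar>b\<bar> < 1"
    unfolding a_def b_def by (auto simp: abs_less_iff tanh_real_lt_1 minus_less_iff tanh_real_gt_neg1)
  have b2: "b\<^sup>2 \<le> 1" and a2: "a\<^sup>2 < 1" using ab by (auto simp: abs_square_le_1 abs_square_less_1)
  have "\<bar>a * b\<bar> < 1" using ab by (metis abs_ge_zero abs_mult mult_strict_mono' mult_1)
  hence pos: "1 + a * b > 0" "1 - a * b > 0" by auto
  have "tanh (r + t) - tanh (r - t) = (a + b) / (1 + a * b) - (a - b) / (1 - a * b)"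
    using tanh_add[of r t] tanh_add[of r "- t"] by (simp add: a_def b_def)
  also have "\<dots> = 2 * b * ((1 - a\<^sup>2) / ((1 + a * b) * (1 - a * b)))"
    using pos by (simp add: field_simps power2_eq_square)
  finally have "\<bar>tanh (r + t) - tanh (r - t)\<bar> = 2 * \<bar>b\<bar> * ((1 - a\<^sup>2) / ((1 + a * b) * (1 - a * b)))"
    using pos a2 by (simp add: abs_mult)
  also have "(1 - a\<^sup>2) / ((1 + a * b) * (1 - a * b)) \<le> 1"
  proof -
    have "a\<^sup>2 * b\<^sup>2 \<le> a\<^sup>2 * 1" using b2 by (intro mult_left_mono) auto
    hence "1 - a\<^sup>2 \<le> (1 + a * b) * (1 - a * b)" by (simp add: algebra_simps power2_eq_square)
    thus ?thesis using pos by (subst divide_le_eq_1_pos) auto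
  qed
  hence "2 * \<bar>b\<bar> * ((1 - a\<^sup>2) / ((1 + a * b) * (1 - a * b))) \<le> 2 * \<bar>b\<bar> * 1"
    by (intro mult_left_mono) auto
  also have "\<bar>b\<bar> = tanh \<bar>t\<bar>" by (simp add: b_def abs_if)
  finally show ?thesis by simp
qed

section \<open>Quadratic forms in the spins and the effect of a single flip\<close>

definition quad_form :: "nat \<Rightarrow> (nat \<Rightarrow> nat \<Rightarrow> real) \<Rightarrow> (nat \<Rightarrow> real) \<Rightarrow> real" where
  "quad_form n a x = (\<Sum>u<n. \<Sum>v<n. a u v * x u * x v)"

text \<open>Exactly the row and the column of \<open>w\<close> change, each by twice a linear form.
  The zero diagonal excludes the entry they share and makes the result independent of
  \<open>x w\<close>.\<close>

lemma quad_form_flip: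
  assumes "\<And>u v. u < n \<Longrightarrow> v < n \<Longrightarrow> a u v = a v u" and "\<And>u. u < n \<Longrightarrow> a u u = 0" and w: "w < n"
  shows "quad_form n a (x(w := 1)) - quad_form n a (x(w := -1)) = 4 * (\<Sum>v<n. a w v * x v)"
proof -
  let ?x = "x(w := 1)" and ?y = "x(w := -1)"
  have "quad_form n a ?x - quad_form n a ?y = (\<Sum>u<n. \<Sum>v<n. a u v * ?x u * ?x v - a u v * ?y u * ?y v)"
    by (simp add: quad_form_def sum_subtractf)
  also have "\<dots> = (\<Sum>u<n. \<Sum>v<n. (if u = w then 2 * (a w v * x v) else 0) + (if v = w then 2 * (a w u * x u) else 0))"
    by (intro sum.cong refl) (use assms in auto)
  also have "\<dots> = (\<Sum>u<n. if u = w then \<Sum>v<n. 2 * (a w v * x v) else 0) + (\<Sum>u<n. 2 * (a w u * x u))"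
    unfolding sum.distrib using w
    by (intro arg_cong2[of _ _ _ _ "(+)"] sum.cong refl) auto
  also have "\<dots> = 4 * (\<Sum>v<n. a w v * x v)"
    using w by (simp add: sum_distrib_left[symmetric])
  finally show ?thesis .
qed

text \<open>This gives the log-odds of the spin at \<open>w\<close>. The diagonal of \<theta> may be
  arbitrary, so it is cleared before \<open>quad_form_flip\<close> is applied.\<close>

lemma sum_offdiag_flip:
  fixes \<theta> :: "nat \<Rightarrow> nat \<Rightarrow> real"
  assumes sym: "\<And>u v. u < n \<Longrightarrow> v < n \<Longrightarrow> \<theta> u v = \<theta> v u" and w: "w < n"
  shows "(\<Sum>v<n. \<Sum>u<v. \<theta> u v * (x(w := 1)) u * (x(w := 1)) v) =
    (\<Sum>v<n. \<Sum>u<v. \<theta> u v * (x(w := -1)) u * (x(w := -1)) v) + 2 * (\<Sum>u\<in>{..<n} - {w}. \<theta> u w * x u)"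
proof -
  define a where "a u v = (if u = v then 0 else \<theta> u v)" for u v
  have q: "quad_form n a y = 2 * (\<Sum>v<n. \<Sum>u<v. \<theta> u v * y u * y v)" for y
  proof -
    have "quad_form n a y = 2 * (\<Sum>v<n. \<Sum>u<v. a u v * y u * y v)"
      unfolding quad_form_def by (rule sum_symmetric_pairs) (auto simp: a_def sym)
    also have "(\<Sum>v<n. \<Sum>u<v. a u v * y u * y v) = (\<Sum>v<n. \<Sum>u<v. \<theta> u v * y u * y v)"
      by (intro sum.cong) (auto simp: a_def)
    finally show ?thesis .
  qed
  have "quad_form n a (x(w := 1)) - quad_form n a (x(w := -1)) = 4 * (\<Sum>v<n. a w v * x v)"
    by (rule quad_form_flip) (auto simp: a_def sym w)
  also have "(\<Sum>v<n. a w v * x v) = (\<Sum>u\<in>{..<n} - {w}. \<theta> u w * x u)"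
    using w by (subst sum.remove[of _ w]) (auto simp: a_def sym intro!: sum.cong)
  finally show ?thesis unfolding q by linarith
qed

section \<open>High-temperature Ising models satisfy Dobrushin's condition\<close>

locale ising =
  fixes n :: nat and \<theta> :: "nat \<Rightarrow> nat \<Rightarrow> real" and \<eta> :: real
  assumes n_pos': "0 < n" and eta_pos: "0 < \<eta>"
    and sym: "\<And>u v. u < n \<Longrightarrow> v < n \<Longrightarrow> \<theta> u v = \<theta> v u"
    and ht: "high_temperature n \<eta> \<theta>"
begin

abbreviation model :: "(nat \<Rightarrow> real) pmf" where
  "model \<equiv> ising_pmf n (\<lambda>_. 0) \<theta>"

lemma pmf_model_pos: "x \<in> spin_configs n \<Longrightarrow> pmf model x > 0"
  by (auto simp: pmf_ising ising_weight_def intro!: divide_pos_pos sum_pos)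

lemma set_pmf_model: "set_pmf model = spin_configs n"
proof (intro set_eqI iffI)
  fix x assume "x \<in> spin_configs n"
  thus "x \<in> set_pmf model" using pmf_model_pos[of x] by (simp add: set_pmf_iff)
qed (auto simp: set_pmf_iff pmf_ising split: if_splits)

sublocale spin_measure n "pmf model"
proof
  show "sum (pmf model) (spin_configs n) = 1"
    by (rule sum_pmf_eq_1) (auto simp: set_pmf_model)
qed (rule pmf_model_pos)

definition field :: "nat \<Rightarrow> (nat \<Rightarrow> real) \<Rightarrow> real" where
  "field v x = (\<Sum>u\<in>{..<n} - {v}. \<theta> u v * x u)"

text \<open>The two weights at \<open>v\<close> have the ratio \<open>exp (2 * field v x)\<close>,
  as the partition function cancels; the logistic function of twice the local field is an affine
  image of its tanh.\<close>

lemma cond_up_eq: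
  assumes v: "v < n" and x: "x \<in> spin_configs n"
  shows "cond_up v x = (1 + tanh (field v x)) / 2"
proof -
  define A B where "A = pmf model (x(v := 1))" and "B = pmf model (x(v := -1))"
  have B: "B > 0" using v x by (auto simp: B_def intro!: pmf_model_pos spin_configs_upd)
  have "ising_weight n (\<lambda>_. 0) \<theta> (x(v := 1)) = ising_weight n (\<lambda>_. 0) \<theta> (x(v := -1)) * exp (2 * field v x)"
    using sum_offdiag_flip[where \<theta> = \<theta> and n = n and w = v and x = x, OF sym v]
    by (simp add: ising_weight_def field_def exp_add[symmetric])
  hence "A = B * exp (2 * field v x)"
    using v x by (simp add: A_def B_def pmf_ising spin_configs_upd)
  hence "cond_up v x = (B * exp (2 * field v x)) / (B * (exp (2 * field v x) + 1))"
    by (simp add: cond_up_def A_def[symmetric] B_def[symmetric] algebra_simps)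
  also have "\<dots> = exp (2 * field v x) / (exp (2 * field v x) + 1)" using B by simp
  also have "\<dots> = (1 + tanh (field v x)) / 2"
  proof -
    define e where "e = exp (2 * field v x)"
    have e: "e > 0" by (simp add: e_def)
    have "tanh (field v x) = (1 - 1 / e) / (1 + 1 / e)"
      by (simp add: tanh_real_altdef e_def exp_minus inverse_eq_divide)
    also have "\<dots> = (e * (1 - 1 / e)) / (e * (1 + 1 / e))" using e by simp
    also have "\<dots> = (e - 1) / (e + 1)" using e by (simp add: right_diff_distrib distrib_left)
    finally show ?thesis unfolding e_def[symmetric] using e by (simp add: field_simps)
  qed
  finally show ?thesis .
qed

sublocale dobrushin n "pmf model" "\<lambda>u v. tanh \<bar>\<theta> u v\<bar>" \<eta>
proof
  fix u v x assume u: "u < n" and v: "v < n" and uv: "u \<noteq> v" and x: "x \<in> spin_configs n"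
  \<comment> \<open>The local field at \<open>v\<close> without the contribution of
    \<open>u\<close>: flipping \<open>u\<close> moves the field between
    \<open>r + \<theta> u v\<close> and \<open>r - \<theta> u v\<close>.\<close>
  define r where "r = (\<Sum>w\<in>{..<n} - {v} - {u}. \<theta> w v * x w)"
  have f: "field v (x(u := s)) = r + \<theta> u v * s" for s
  proof -
    have "field v (x(u := s)) = \<theta> u v * s + (\<Sum>w\<in>{..<n} - {v} - {u}. \<theta> w v * (x(u := s)) w)"
      unfolding field_def using u uv by (subst sum.remove[of _ u]) auto
    also have "(\<Sum>w\<in>{..<n} - {v} - {u}. \<theta> w v * (x(u := s)) w) = r"
      unfolding r_def by (intro sum.cong) auto
    finally show ?thesis by (simp add: fun_upd_def)
  qed
  have "cond_up v (x(u := 1)) - cond_up v (x(u := -1)) = (tanh (r + \<theta> u v) - tanh (r - \<theta> u v)) / 2"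
    using u v x by (simp add: cond_up_eq spin_configs_upd f diff_divide_distrib add_divide_distrib)
  thus "\<bar>cond_up v (x(u := 1)) - cond_up v (x(u := -1))\<bar> \<le> tanh \<bar>\<theta> u v\<bar>"
    using abs_tanh_diff_le[of r "\<theta> u v"] by simp
next
  fix v assume "v < n"
  thus "(\<Sum>u\<in>{..<n} - {v}. tanh \<bar>\<theta> u v\<bar>) \<le> 1 - \<eta>"
    using ht unfolding high_temperature_def by (meson Max_ge finite_imageI finite_lessThan imageI lessThan_iff order_trans)
qed (use n_pos' eta_pos in auto)

text \<open>The weight is even under the global spin flip, as there is no external field.\<close>

lemma mean_spin [simp]: "mean (\<lambda>x. x v) = 0"
proof -
  have "mean (\<lambda>x. x v) = (\<Sum>x\<in>spin_configs n. pmf model (\<lambda>u. - x u) * - x v)"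
    unfolding mean_def by (rule sum_spin_uminus[symmetric])
  also have "\<dots> = - mean (\<lambda>x. x v)"
    unfolding mean_def sum_negf[symmetric]
    by (intro sum.cong) (auto simp: pmf_ising ising_weight_def spin_configs_uminus)
  finally show ?thesis by simp
qed

text \<open>A linear form is centred, and a flip at \<open>w\<close> changes it by the constant
  \<open>2 * a w\<close>; the square of 2 cancels the 4 in the Poincare inequality.\<close>

lemma mean_linear_square_le:
  "mean (\<lambda>x. (\<Sum>v<n. a v * x v)\<^sup>2) \<le> (\<Sum>v<n. (a v)\<^sup>2) / \<eta>"
proof -
  have "mean (\<lambda>x. \<Sum>v<n. a v * x v) = 0" by (simp add: mean_sum mean_cmult)
  note poincare_centered[OF this]
  also have "(\<Sum>w<n. mean (\<lambda>x. ((\<Sum>v<n. a v * (x(w := 1)) v) - (\<Sum>v<n. a v * (x(w := -1)) v))\<^sup>2))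
    = (\<Sum>w<n. 4 * (a w)\<^sup>2)"
  proof (intro sum.cong refl)
    fix w assume w: "w \<in> {..<n}"
    have "(\<Sum>v<n. a v * (x(w := 1)) v) - (\<Sum>v<n. a v * (x(w := -1)) v) = 2 * a w" for x
    proof -
      have "(\<Sum>v<n. a v * (x(w := 1)) v) - (\<Sum>v<n. a v * (x(w := -1)) v) =
          (\<Sum>v<n. if v = w then 2 * a w else 0)"
        unfolding sum_subtractf[symmetric] by (intro sum.cong) auto
      thus ?thesis using w by simp
    qed
    thus "mean (\<lambda>x. ((\<Sum>v<n. a v * (x(w := 1)) v) - (\<Sum>v<n. a v * (x(w := -1)) v))\<^sup>2) = 4 * (a w)\<^sup>2"
      by (simp add: power_mult_distrib)
  qed
  finally show ?thesis
    using eta_pos by (simp add: sum_distrib_left[symmetric] field_simps)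
qed

text \<open>The increments of a quadratic form under flips are linear forms, hence bounded by
  \<open>mean_linear_square_le\<close>. Each of the two passes costs a factor 1/\<eta>.\<close>

lemma variance_quad_form_le:
  assumes "\<And>u v. u < n \<Longrightarrow> v < n \<Longrightarrow> a u v = a v u" and "\<And>u. u < n \<Longrightarrow> a u u = 0"
  shows "mean (\<lambda>x. (quad_form n a x - mean (quad_form n a))\<^sup>2) \<le> 4 * (\<Sum>u<n. \<Sum>v<n. (a u v)\<^sup>2) / \<eta>\<^sup>2"
proof -
  note poincare[of "quad_form n a"]
  also have "(\<Sum>w<n. mean (\<lambda>x. (quad_form n a (x(w := 1)) - quad_form n a (x(w := -1)))\<^sup>2)) / 4
     = (\<Sum>w<n. 4 * mean (\<lambda>x. (\<Sum>v<n. a w v * x v)\<^sup>2))"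
    unfolding sum_divide_distrib
    by (intro sum.cong refl) (simp add: quad_form_flip[OF assms] power_mult_distrib mean_cmult)
  also have "\<dots> \<le> (\<Sum>w<n. 4 * ((\<Sum>v<n. (a w v)\<^sup>2) / \<eta>))"
    by (intro sum_mono mult_left_mono mean_linear_square_le) auto
  also have "\<dots> = 4 * (\<Sum>u<n. \<Sum>v<n. (a u v)\<^sup>2) / \<eta>"
    by (simp add: sum_distrib_left[symmetric] sum_divide_distrib[symmetric])
  finally show ?thesis
    using eta_pos by (simp add: field_simps power2_eq_square)
qed

text \<open>The diagonal is set to 0 because the true entries there are all 1 and would hide the
  signal.\<close>

definition corr :: "nat \<Rightarrow> nat \<Rightarrow> real" where
  "corr u v = (if u = v then 0 else mean (\<lambda>x. x u * x v))"

definition corr_norm :: real where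
  "corr_norm = (\<Sum>u<n. \<Sum>v<n. (corr u v)\<^sup>2)"

lemma corr_sym: "corr u v = corr v u"
  by (simp add: corr_def mult.commute)

lemma corr_norm_nonneg: "corr_norm \<ge> 0"
  by (auto simp: corr_norm_def intro!: sum_nonneg)

text \<open>The squared norm \<open>r\<close> of a row is the mean of \<open>x u\<close> times the
  linear form with that row as coefficients. Cauchy-Schwarz gives
  \<open>r\<^sup>2 \<le> r / \<eta>\<close>, so \<open>r \<le> 1 / \<eta>\<close>.\<close>

lemma corr_norm_le: "corr_norm \<le> real n / \<eta>"
proof -
  have row: "(\<Sum>v<n. (corr u v)\<^sup>2) \<le> 1 / \<eta>" if u: "u < n" for u
  proof -
    let ?r = "\<Sum>v<n. (corr u v)\<^sup>2"
    have "mean (\<lambda>x. x u * (\<Sum>v<n. corr u v * x v)) = (\<Sum>v<n. corr u v * mean (\<lambda>x. x u * x v))"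
      by (simp add: sum_distrib_left mean_sum mean_cmult[symmetric] mult.left_commute)
    also have "\<dots> = ?r"
      by (intro sum.cong) (auto simp: corr_def power2_eq_square)
    finally have "?r\<^sup>2 \<le> mean (\<lambda>x. (x u)\<^sup>2) * mean (\<lambda>x. (\<Sum>v<n. corr u v * x v)\<^sup>2)"
      using mean_Cauchy_Schwarz[of "\<lambda>x. x u" "\<lambda>x. \<Sum>v<n. corr u v * x v"] by simp
    also have "mean (\<lambda>x. (x u)\<^sup>2) = mean (\<lambda>_. 1)"
      using u by (intro mean_cong) (auto simp: spin_configs_iff)
    also have "mean (\<lambda>_. 1) * mean (\<lambda>x. (\<Sum>v<n. corr u v * x v)\<^sup>2) \<le> ?r / \<eta>"
      using mean_linear_square_le[of "corr u"] by simp
    finally have *: "?r * ?r \<le> ?r * (1 / \<eta>)" by (simp add: power2_eq_square)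
    have "?r \<ge> 0" by (intro sum_nonneg) auto
    thus ?thesis using * eta_pos by (cases "?r = 0") (auto simp del: times_divide_eq_right)
  qed
  have "corr_norm \<le> (\<Sum>u<n. 1 / \<eta>)"
    unfolding corr_norm_def by (intro sum_mono row) auto
  thus ?thesis by simp
qed

end

section \<open>The kernel of the U-statistic\<close>

lemma spin_mult_square: "a = -1 \<or> a = 1 \<Longrightarrow> b = -1 \<or> b = 1 \<Longrightarrow> a * b * (a * b) = (1 :: real)"
  by auto

text \<open>Subtracting \<open>n\<close> removes the diagonal of the squared overlap. What remains
  is an unbiased estimator of \<open>corr_norm\<close> from two independent samples.\<close>

definition overlap_kernel :: "nat \<Rightarrow> (nat \<Rightarrow> real) \<Rightarrow> (nat \<Rightarrow> real) \<Rightarrow> real" where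
  "overlap_kernel n x y = (\<Sum>u<n. x u * y u)\<^sup>2 - real n"

lemma overlap_kernel_sym: "overlap_kernel n x y = overlap_kernel n y x"
  by (simp add: overlap_kernel_def mult.commute)

lemma overlap_kernel_quad:
  assumes "x \<in> spin_configs n" "y \<in> spin_configs n"
  shows "overlap_kernel n x y = quad_form n (\<lambda>u v. if u = v then 0 else y u * y v) x"
proof -
  have "(\<Sum>u<n. x u * y u)\<^sup>2 = (\<Sum>u<n. \<Sum>v<n. (x u * y u) * (x v * y v))"
    by (simp add: power2_eq_square sum_product)
  also have "\<dots> = (\<Sum>u<n. \<Sum>v<n. (if u = v then 0 else y u * y v) * x u * x v + (if v = u then 1 else 0))"
    by (intro sum.cong refl) (use assms in \<open>auto simp: spin_configs_iff spin_mult_square\<close>)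
  also have "\<dots> = quad_form n (\<lambda>u v. if u = v then 0 else y u * y v) x + n"
    by (simp add: quad_form_def sum.distrib)
  finally show ?thesis by (simp add: overlap_kernel_def)
qed

context ising
begin

lemma mean_overlap_kernel:
  assumes "y \<in> spin_configs n"
  shows "mean (\<lambda>x. overlap_kernel n x y) = quad_form n corr y"
proof -
  have "mean (\<lambda>x. overlap_kernel n x y) = mean (quad_form n (\<lambda>u v. if u = v then 0 else y u * y v))"
    by (rule mean_cong) (simp add: overlap_kernel_quad assms)
  also have "\<dots> = (\<Sum>u<n. \<Sum>v<n. mean (\<lambda>x. (if u = v then 0 else y u * y v) * (x u * x v)))"
    by (simp add: quad_form_def[abs_def] mean_sum mult.assoc)
  also have "\<dots> = quad_form n corr y"
    unfolding quad_form_def mean_cmult by (intro sum.cong) (auto simp: corr_def)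
  finally show ?thesis .
qed

lemma mean_quad_form_corr: "mean (quad_form n corr) = corr_norm"
proof -
  have "mean (quad_form n corr) = (\<Sum>u<n. \<Sum>v<n. corr u v * mean (\<lambda>x. x u * x v))"
    by (simp add: quad_form_def[abs_def] mean_sum mult.assoc mean_cmult)
  also have "\<dots> = corr_norm"
    unfolding corr_norm_def by (intro sum.cong) (auto simp: corr_def power2_eq_square)
  finally show ?thesis .
qed

text \<open>The coefficients of the first projection are the correlations themselves, so its
  variance is controlled by \<open>corr_norm\<close> instead of \<open>n\<^sup>2\<close> and
  vanishes for the uniform measure.\<close>

lemma variance_quad_form_corr: "mean (\<lambda>y. (quad_form n corr y - corr_norm)\<^sup>2) \<le> 4 * corr_norm / \<eta>\<^sup>2"
  using variance_quad_form_le[of corr] corr_sym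
  by (simp add: mean_quad_form_corr corr_norm_def) (simp add: corr_def)

text \<open>Law of total variance: for fixed \<open>y\<close> the kernel is a quadratic form with
  off-diagonal coefficients of modulus 1, and its conditional mean is the first projection.\<close>

lemma variance_overlap_kernel:
  "mean (\<lambda>y. mean (\<lambda>x. (overlap_kernel n x y - corr_norm)\<^sup>2)) \<le> 4 * (real n)\<^sup>2 / \<eta>\<^sup>2 + 4 * corr_norm / \<eta>\<^sup>2"
proof -
  have "mean (\<lambda>x. (overlap_kernel n x y - corr_norm)\<^sup>2) \<le>
      4 * (real n)\<^sup>2 / \<eta>\<^sup>2 + (quad_form n corr y - corr_norm)\<^sup>2" if y: "y \<in> spin_configs n" for y
  proof -
    define a where "a u v = (if u = v then 0 else y u * y v)" for u v
    define k where "k x = quad_form n a x" for x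
    have mk: "mean k = quad_form n corr y"
      unfolding mean_overlap_kernel[OF y, symmetric]
      by (rule mean_cong) (simp add: k_def a_def[abs_def] overlap_kernel_quad y)
    have "mean (\<lambda>x. (overlap_kernel n x y - corr_norm)\<^sup>2) = mean (\<lambda>x. (k x - corr_norm)\<^sup>2)"
      by (rule mean_cong) (simp add: k_def a_def[abs_def] overlap_kernel_quad y)
    also have "\<dots> = mean (\<lambda>x. (k x - mean k)\<^sup>2 + (2 * (mean k - corr_norm)) * (k x - mean k) + (mean k - corr_norm)\<^sup>2)"
      by (rule mean_cong) (simp add: power2_eq_square algebra_simps)
    also have "\<dots> = mean (\<lambda>x. (k x - mean k)\<^sup>2) + (mean k - corr_norm)\<^sup>2"
      by (simp only: mean_add mean_cmult mean_diff mean_const) simp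
    also have "mean (\<lambda>x. (k x - mean k)\<^sup>2) \<le> 4 * (\<Sum>u<n. \<Sum>v<n. (a u v)\<^sup>2) / \<eta>\<^sup>2"
      unfolding k_def by (rule variance_quad_form_le) (auto simp: a_def mult.commute)
    also have "\<dots> \<le> 4 * (\<Sum>u<n. \<Sum>v<n. 1) / \<eta>\<^sup>2"
      by (intro divide_right_mono mult_left_mono sum_mono)
         (use y in \<open>auto simp: a_def spin_configs_iff power2_eq_square spin_mult_square\<close>)
    finally show ?thesis by (simp add: mk power2_eq_square)
  qed
  hence "mean (\<lambda>y. mean (\<lambda>x. (overlap_kernel n x y - corr_norm)\<^sup>2)) \<le>
     mean (\<lambda>y. 4 * (real n)\<^sup>2 / \<eta>\<^sup>2 + (quad_form n corr y - corr_norm)\<^sup>2)"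
    by (rule mean_mono)
  also have "\<dots> \<le> 4 * (real n)\<^sup>2 / \<eta>\<^sup>2 + 4 * corr_norm / \<eta>\<^sup>2"
    using variance_quad_form_corr by (simp only: mean_add mean_const)
  finally show ?thesis .
qed

end

section \<open>Variance of a U-statistic\<close>

lemma integrable_finite_pmf [simp]:
  "finite (set_pmf p) \<Longrightarrow> integrable (measure_pmf p) (f :: _ \<Rightarrow> real)"
  by (rule integrable_measure_pmf_finite)

lemma expectation_swap:
  fixes F :: "'a \<Rightarrow> 'b \<Rightarrow> real"
  assumes "finite (set_pmf p)" "finite (set_pmf q)"
  shows "measure_pmf.expectation p (\<lambda>x. measure_pmf.expectation q (F x)) =
    measure_pmf.expectation q (\<lambda>y. measure_pmf.expectation p (\<lambda>x. F x y))"
proof -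
  have 1: "measure_pmf.expectation p f = (\<Sum>x\<in>set_pmf p. pmf p x * f x)" for f :: "'a \<Rightarrow> real"
    using assms by (subst integral_measure_pmf[of "set_pmf p"]) auto
  have 2: "measure_pmf.expectation q f = (\<Sum>x\<in>set_pmf q. pmf q x * f x)" for f :: "'b \<Rightarrow> real"
    using assms by (subst integral_measure_pmf[of "set_pmf q"]) auto
  show ?thesis
    unfolding 1 2 sum_distrib_left by (subst sum.swap) (simp add: mult.left_commute)
qed

locale iid_samples =
  fixes p :: "'a pmf" and d :: 'a
  assumes fin [simp]: "finite (set_pmf p)"
begin

abbreviation E :: "('a \<Rightarrow> real) \<Rightarrow> real" where
  "E \<equiv> measure_pmf.expectation p"

abbreviation samples :: "nat \<Rightarrow> (nat \<Rightarrow> 'a) pmf" where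
  "samples m \<equiv> Pi_pmf {..<m} d (\<lambda>_. p)"

abbreviation ES :: "nat \<Rightarrow> ((nat \<Rightarrow> 'a) \<Rightarrow> real) \<Rightarrow> real" where
  "ES m \<equiv> measure_pmf.expectation (samples m)"

lemma finite_samples [simp]: "finite (set_pmf (samples m))"
  by (simp add: set_Pi_pmf finite_PiE_dflt)

text \<open>Splitting off the last sample allows the moments below to be computed by induction on
  \<open>m\<close>.\<close>

lemma ES_Suc: "ES (Suc m) F = E (\<lambda>x. ES m (\<lambda>X. F (X(m := x))))"
proof -
  have "samples (Suc m) = do {x \<leftarrow> p; X \<leftarrow> samples m; return_pmf (X(m := x))}"
    unfolding lessThan_Suc by (rule Pi_pmf_insert') auto
  also have "\<dots> = do {x \<leftarrow> p; map_pmf (\<lambda>X. X(m := x)) (samples m)}"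
    by (simp add: map_pmf_def)
  finally have "ES (Suc m) F = (\<Sum>x\<in>set_pmf p. pmf p x *\<^sub>R measure_pmf.expectation (map_pmf (\<lambda>X. X(m := x)) (samples m)) F)"
    by (simp add: pmf_expectation_bind[of "set_pmf p"])
  also have "\<dots> = E (\<lambda>x. ES m (\<lambda>X. F (X(m := x))))"
    by (subst integral_measure_pmf[of "set_pmf p"]) auto
  finally show ?thesis .
qed

lemma ES_sum: "ES m (\<lambda>X. \<Sum>i<m. h (X i)) = real m * E h"
proof (induction m)
  case (Suc m)
  have "ES (Suc m) (\<lambda>X. \<Sum>i<Suc m. h (X i)) = E (\<lambda>x. ES m (\<lambda>X. (\<Sum>i<m. h (X i)) + h x))"
    by (simp add: ES_Suc)
  also have "\<dots> = real (Suc m) * E h"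
    by (simp add: Suc algebra_simps)
  finally show ?case .
qed simp

lemma ES_sum_square:
  assumes "E h = 0"
  shows "ES m (\<lambda>X. (\<Sum>i<m. h (X i))\<^sup>2) = real m * E (\<lambda>x. (h x)\<^sup>2)"
proof (induction m)
  case (Suc m)
  have "ES (Suc m) (\<lambda>X. (\<Sum>i<Suc m. h (X i))\<^sup>2) =
      E (\<lambda>x. ES m (\<lambda>X. (\<Sum>i<m. h (X i))\<^sup>2 + 2 * h x * (\<Sum>i<m. h (X i)) + (h x)\<^sup>2))"
    by (simp add: ES_Suc power2_sum algebra_simps)
  also have "\<dots> = real (Suc m) * E (\<lambda>x. (h x)\<^sup>2)"
    by (simp add: Suc ES_sum assms algebra_simps)
  finally show ?case .
qed simp

text \<open>For a degenerate kernel, terms belonging to different pairs of samples are orthogonal,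
  so only the squares of the pairs survive.\<close>

lemma ES_degenerate_square:
  assumes sym: "\<And>x y. h x y = h y x" and deg: "\<And>y. E (\<lambda>x. h x y) = 0"
  shows "ES m (\<lambda>X. (\<Sum>i<m. \<Sum>j<i. h (X i) (X j))\<^sup>2) =
    (real m * (real m - 1) / 2) * E (\<lambda>x. E (\<lambda>y. (h x y)\<^sup>2))"
proof (induction m)
  case (Suc m)
  define H where "H X = (\<Sum>i<m. \<Sum>j<i. h (X i) (X j))" for X
  define S where "S x X = (\<Sum>j<m. h x (X j))" for x X
  \<comment> \<open>\<open>H\<close> involves only the earlier samples; averaging over the new
    sample \<open>x\<close> first annihilates \<open>S x X\<close>.\<close>
  have cross: "E (\<lambda>x. ES m (\<lambda>X. H X * S x X)) = 0"
    unfolding S_def by (subst expectation_swap) (simp_all add: deg)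
  have "E (\<lambda>y. h x y) = 0" for x
    using deg[of x] by (simp add: sym[of x])
  hence square: "ES m (\<lambda>X. (S x X)\<^sup>2) = real m * E (\<lambda>y. (h x y)\<^sup>2)" for x
    unfolding S_def by (rule ES_sum_square)
  have "(\<Sum>i<Suc m. \<Sum>j<i. h ((X(m := x)) i) ((X(m := x)) j)) = H X + S x X" for x X
    by (simp add: H_def S_def)
  hence "ES (Suc m) (\<lambda>X. (\<Sum>i<Suc m. \<Sum>j<i. h (X i) (X j))\<^sup>2) =
      E (\<lambda>x. ES m (\<lambda>X. (H X + S x X)\<^sup>2))"
    by (simp only: ES_Suc)
  also have "\<dots> = E (\<lambda>x. ES m (\<lambda>X. (H X)\<^sup>2 + 2 * (H X * S x X) + (S x X)\<^sup>2))"
    by (simp only: power2_sum mult.assoc add.assoc add.commute add.left_commute)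
  also have "\<dots> = ES m (\<lambda>X. (H X)\<^sup>2) + real m * E (\<lambda>x. E (\<lambda>y. (h x y)\<^sup>2))"
    by (simp add: cross square)
  finally show ?case
    using Suc by (simp add: H_def algebra_simps add_divide_distrib diff_divide_distrib)
qed simp

text \<open>Hoeffding decomposition: a centred symmetric kernel is the sum of its two projections and of a
  degenerate remainder.\<close>

lemma U_statistic_variance:
  fixes K :: "'a \<Rightarrow> 'a \<Rightarrow> real"
  assumes sym: "\<And>x y. K x y = K y x"
  defines "g \<equiv> \<lambda>y. E (\<lambda>x. K x y)"
  defines "s \<equiv> E g"
  shows "ES m (\<lambda>X. ((\<Sum>i<m. \<Sum>j<i. K (X i) (X j)) - real m * (real m - 1) / 2 * s)\<^sup>2) \<le>
    2 * real m ^ 3 * E (\<lambda>y. (g y - s)\<^sup>2) + (real m)\<^sup>2 * E (\<lambda>y. E (\<lambda>x. (K x y - s)\<^sup>2))"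
proof -
  define k where "k x y = K x y - s" for x y
  define g' where "g' y = g y - s" for y
  define h where "h x y = k x y - g' x - g' y" for x y
  define \<sigma> V where "\<sigma> = E (\<lambda>y. (g' y)\<^sup>2)" and "V = E (\<lambda>y. E (\<lambda>x. (k x y)\<^sup>2))"
  have ksym: "k x y = k y x" for x y by (simp add: k_def sym)
  hence hsym: "h x y = h y x" for x y by (simp add: h_def)
  have Ek: "E (\<lambda>x. k x y) = g' y" for y by (simp add: k_def g'_def g_def)
  hence Ek': "E (\<lambda>y. k x y) = g' x" for x by (simp add: ksym[of x])
  have Eg: "E g' = 0" by (simp add: g'_def[abs_def] s_def)
  have \<sigma>0: "\<sigma> \<ge> 0" and V0: "V \<ge> 0" unfolding \<sigma>_def V_def by auto
  have h2: "E (\<lambda>y. E (\<lambda>x. (h x y)\<^sup>2)) = V - 2 * \<sigma>"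
  proof -
    have 1: "E (\<lambda>y. E (\<lambda>x. k x y * g' x)) = \<sigma>"
      by (subst expectation_swap) (simp_all add: Ek' \<sigma>_def power2_eq_square)
    have 2: "E (\<lambda>y. E (\<lambda>x. k x y * g' y)) = \<sigma>"
      by (simp add: Ek \<sigma>_def power2_eq_square)
    have "E (\<lambda>y. E (\<lambda>x. (h x y)\<^sup>2)) = E (\<lambda>y. E (\<lambda>x. (k x y)\<^sup>2 + (g' x)\<^sup>2 + (g' y)\<^sup>2
        - 2 * (k x y * g' x) - 2 * (k x y * g' y) + 2 * (g' y * g' x)))"
      by (simp add: h_def power2_eq_square algebra_simps)
    also have "\<dots> = V - 2 * \<sigma>"
      using 1 2 by (simp add: Eg V_def \<sigma>_def)
    finally show ?thesis .
  qed
  have lin: "(\<Sum>i<m. \<Sum>j<i. g' (X i) + g' (X j)) = (real m - 1) * (\<Sum>i<m. g' (X i))" for X :: "nat \<Rightarrow> 'a"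
    by (induction m) (auto simp: sum.distrib algebra_simps)
  have cnt: "(\<Sum>i<m. \<Sum>j<i. s) = real m * (real m - 1) / 2 * s"
    by (induction m) (auto simp: field_simps)
  let ?A = "\<lambda>X. (\<Sum>i<m. g' (X i))" and ?H = "\<lambda>X. \<Sum>i<m. \<Sum>j<i. h (X i) (X j)"
  have "(\<Sum>i<m. \<Sum>j<i. K (X i) (X j)) - real m * (real m - 1) / 2 * s = (real m - 1) * ?A X + ?H X" for X
    unfolding lin[symmetric] cnt[symmetric] sum_subtractf[symmetric] sum.distrib[symmetric]
    by (simp add: h_def k_def)
  hence "ES m (\<lambda>X. ((\<Sum>i<m. \<Sum>j<i. K (X i) (X j)) - real m * (real m - 1) / 2 * s)\<^sup>2) =
     ES m (\<lambda>X. ((real m - 1) * ?A X + ?H X)\<^sup>2)" by simp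
  \<comment> \<open>The factor 2 makes it unnecessary to show that the linear and the degenerate
    part are orthogonal.\<close>
  also have "\<dots> \<le> ES m (\<lambda>X. 2 * (real m - 1)\<^sup>2 * (?A X)\<^sup>2 + 2 * (?H X)\<^sup>2)"
  proof (rule integral_mono)
    fix X
    have *: "(a + b)\<^sup>2 \<le> 2 * a\<^sup>2 + 2 * b\<^sup>2" for a b :: real
      using zero_le_power2[of "a - b"] by (simp add: power2_diff power2_sum)
    show "((real m - 1) * ?A X + ?H X)\<^sup>2 \<le> 2 * (real m - 1)\<^sup>2 * (?A X)\<^sup>2 + 2 * (?H X)\<^sup>2"
      using *[of "(real m - 1) * ?A X" "?H X"] by (simp only: power_mult_distrib mult.assoc)
  qed simp_all
  also have "\<dots> = 2 * (real m - 1)\<^sup>2 * ES m (\<lambda>X. (?A X)\<^sup>2) + 2 * ES m (\<lambda>X. (?H X)\<^sup>2)"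
    by (subst Bochner_Integration.integral_add) simp_all
  also have "ES m (\<lambda>X. (?A X)\<^sup>2) = real m * \<sigma>"
    unfolding \<sigma>_def by (rule ES_sum_square[OF Eg])
  also have "ES m (\<lambda>X. (?H X)\<^sup>2) = real m * (real m - 1) / 2 * (V - 2 * \<sigma>)"
  proof -
    have "E (\<lambda>x. h x y) = 0" for y by (simp add: h_def Ek Eg)
    thus ?thesis
      unfolding h2[symmetric] using ES_degenerate_square[of h m] hsym
      by (subst expectation_swap) auto
  qed
  also have "2 * (real m - 1)\<^sup>2 * (real m * \<sigma>) + 2 * (real m * (real m - 1) / 2 * (V - 2 * \<sigma>))
      \<le> 2 * real m ^ 3 * \<sigma> + (real m)\<^sup>2 * V"
  proof (cases "m = 0")
    case False
    hence m: "real m \<ge> 1" by simp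
    have "2 * (real m - 1)\<^sup>2 * (real m * \<sigma>) \<le> 2 * (real m)\<^sup>2 * (real m * \<sigma>)"
      using m \<sigma>0 by (intro mult_right_mono mult_left_mono power_mono) auto
    moreover have "real m * (real m - 1) * (V - 2 * \<sigma>) \<le> real m * (real m - 1) * V"
      using m \<sigma>0 by (intro mult_left_mono) auto
    moreover have "real m * (real m - 1) * V \<le> real m * real m * V"
      using m V0 by (intro mult_right_mono mult_left_mono) auto
    moreover have "2 * (real m * (real m - 1) / 2 * (V - 2 * \<sigma>)) = real m * (real m - 1) * (V - 2 * \<sigma>)"
      by simp
    moreover have "2 * (real m)\<^sup>2 * (real m * \<sigma>) = 2 * real m ^ 3 * \<sigma>" "real m * real m * V = (real m)\<^sup>2 * V"
      by (simp_all add: power2_eq_square power3_eq_cube)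
    ultimately show ?thesis by linarith
  qed simp
  finally show ?thesis by (simp add: \<sigma>_def V_def g'_def k_def)
qed

lemma prob_square_ge:
  fixes Y :: "(nat \<Rightarrow> 'a) \<Rightarrow> real"
  assumes "a > 0"
  shows "measure_pmf.prob (samples m) {X. a \<le> \<bar>Y X\<bar>} \<le> ES m (\<lambda>X. (Y X)\<^sup>2) / a\<^sup>2"
proof -
  have "{X. a \<le> \<bar>Y X\<bar>} = {X \<in> space (measure_pmf (samples m)). a\<^sup>2 \<le> (Y X)\<^sup>2}"
    using assms abs_le_square_iff[of a] by auto
  thus ?thesis
    using integral_Markov_inequality_measure[of "measure_pmf (samples m)" "\<lambda>X. (Y X)\<^sup>2" "{}" "a\<^sup>2"] assms by simp
qed

end

section \<open>The test as a program\<close>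

lemma floor_minus_one [simp]: "\<lfloor>- 1 :: real\<rfloor> = - 1"
  by linarith

text \<open>An upper bound in place of the exact step count, so that branches of different length
  can be treated alike.\<close>

definition runs :: "prog \<Rightarrow> memory \<Rightarrow> nat \<Rightarrow> memory \<Rightarrow> bool" where
  "runs c s b s' \<longleftrightarrow> (\<exists>t\<le>b. exec c s t s')"

lemma runs_Assign: "runs (Assign (Num r) e) s 1 (s(r := eval_expr e s))"
  using exec.assign[of "Num r" e s] by (auto simp: runs_def)

lemma runs_Seq: "runs c1 s b1 s1 \<Longrightarrow> runs c2 s1 b2 s2 \<Longrightarrow> runs (Seq c1 c2) s (b1 + b2) s2"
  unfolding runs_def by (meson add_mono exec.seq)

lemma runs_IfLess:
  "runs (if eval_expr e1 s < eval_expr e2 s then c1 else c2) s b s' \<Longrightarrow> runs (IfLess e1 e2 c1 c2) s (Suc b) s'"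
  unfolding runs_def by (auto split: if_splits intro: exec.if_true exec.if_false)

lemma runs_mono: "runs c s b s' \<Longrightarrow> b \<le> b' \<Longrightarrow> runs c s b' s'"
  unfolding runs_def by (meson order_trans)

text \<open>Rule for loops with \<open>N\<close> rounds, where \<open>P k\<close> is the invariant
  after \<open>k\<close> rounds. Each round costs one test and the body; the leading 1 is the final
  failing test.\<close>

lemma runs_WhileLess:
  assumes body: "\<And>k s. k < N \<Longrightarrow> P k s \<Longrightarrow> eval_expr e1 s < eval_expr e2 s \<and> (\<exists>s'. runs c s b s' \<and> P (Suc k) s')"
    and stop: "\<And>s. P N s \<Longrightarrow> \<not> eval_expr e1 s < eval_expr e2 s"
    and init: "P 0 s"
  shows "\<exists>s'. runs (WhileLess e1 e2 c) s (1 + N * (b + 1)) s' \<and> P N s'"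
proof -
  have "\<exists>s'. runs (WhileLess e1 e2 c) s (1 + (N - k) * (b + 1)) s' \<and> P N s'" if "k \<le> N" "P k s" for k s
    using that
  proof (induction k arbitrary: s rule: inc_induct)
    case base
    thus ?case using exec.while_false[of e1 s e2 c] stop by (auto simp: runs_def)
  next
    case (step k)
    obtain s1 where s1: "eval_expr e1 s < eval_expr e2 s" "runs c s b s1" "P (Suc k) s1"
      using body step by blast
    obtain s2 where s2: "runs (WhileLess e1 e2 c) s1 (1 + (N - Suc k) * (b + 1)) s2" "P N s2"
      using step.IH s1 by blast
    obtain t1 t2 where t: "exec c s t1 s1" "t1 \<le> b" "exec (WhileLess e1 e2 c) s1 t2 s2"
      "t2 \<le> 1 + (N - Suc k) * (b + 1)" using s1 s2 by (auto simp: runs_def)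
    have "N - k = Suc (N - Suc k)" using step by simp
    hence "Suc (t1 + t2) \<le> 1 + (N - k) * (b + 1)" using t by simp
    thus ?case using exec.while_true[OF s1(1) t(1,3)] s2(2) by (auto simp: runs_def)
  qed
  from this[of 0 s] init show ?thesis by simp
qed

section \<open>The instructions of the tester\<close>

abbreviation reg :: "int \<Rightarrow> expr" where
  "reg r \<equiv> Mem (Num r)"

definition add_to :: "int \<Rightarrow> expr \<Rightarrow> prog" where
  "add_to r e = Assign (Num r) (Plus (reg r) e)"

definition sub_from :: "int \<Rightarrow> expr \<Rightarrow> prog" where
  "sub_from r e = Assign (Num r) (Minus (reg r) e)"

lemma runs_add_to: "runs (add_to r e) s 1 (s(r := s r + eval_expr e s))"
  using runs_Assign[of r "Plus (reg r) e" s] by (simp add: add_to_def)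

lemma runs_sub_from: "runs (sub_from r e) s 1 (s(r := s r - eval_expr e s))"
  using runs_Assign[of r "Minus (reg r) e" s] by (simp add: sub_from_def)

text \<open>The input occupies nonnegative addresses, so the variables live at negative ones: the outer and the
  inner loop counter at -1 and -2, the vertex at -3, the addresses of the two current samples at
  -4 and -5, their overlap at -6 and the test statistic at -7. Squaring the overlap amounts to running
  \<open>overlap_loop\<close> a second time with the overlap itself as the increment.\<close>

definition overlap_loop :: "int \<Rightarrow> expr \<Rightarrow> prog" where
  "overlap_loop r e =
     Seq (Assign (Num (-3)) (Num 0))
       (WhileLess (reg (-3)) (reg 0)
         (Seq (IfLess (Mem (Plus (reg (-4)) (reg (-3)))) (Mem (Plus (reg (-5)) (reg (-3)))) (sub_from r e)
                (IfLess (Mem (Plus (reg (-5)) (reg (-3)))) (Mem (Plus (reg (-4)) (reg (-3)))) (sub_from r e)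
                  (add_to r e)))
              (add_to (-3) (Num 1))))"

definition pair_body :: prog where
  "pair_body =
     Seq (Assign (Num (-6)) (Num 0)) (Seq (overlap_loop (-6) (Num 1)) (Seq (overlap_loop (-7) (reg (-6)))
       (Seq (sub_from (-7) (reg 0)) (Seq (add_to (-2) (Num 1)) (add_to (-5) (reg 0))))))"

definition sample_body :: prog where
  "sample_body =
     Seq (Assign (Num (-2)) (Num 0)) (Seq (Assign (Num (-5)) (Num 4))
       (Seq (sub_from (-7) (Plus (Plus (reg 0) (reg 0)) (Plus (reg 0) (reg 0))))
         (Seq (WhileLess (reg (-2)) (reg (-1)) pair_body)
           (Seq (add_to (-1) (Num 1)) (add_to (-4) (reg 0))))))"

definition tester :: prog where
  "tester =
     Seq (Assign (Num (-4)) (Num 4)) (Seq (WhileLess (reg (-1)) (reg 1) sample_body)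
       (IfLess (Num 0) (reg (-7)) (Assign (Num 0) (Num 0)) (Assign (Num 0) (Num 1))))"

text \<open>Two strict comparisons replace the product of spins: the product is -1 if one of them
  holds and 1 if neither does. The target \<open>r\<close> must avoid the registers that steer the
  loop, and \<open>e\<close> must keep its value while the loop writes to -3 and \<open>r\<close>;
  both uses, with a constant and with the overlap, comply.\<close>

lemma runs_overlap_loop:
  assumes r: "r < -5" and n: "s 0 = real n" and a: "s (-4) = real a" and b: "s (-5) = real b"
    and x: "\<And>u. u < n \<Longrightarrow> s (int (a + u)) = x u" "\<And>u. u < n \<Longrightarrow> x u = -1 \<or> x u = 1"
    and y: "\<And>u. u < n \<Longrightarrow> s (int (b + u)) = y u" "\<And>u. u < n \<Longrightarrow> y u = -1 \<or> y u = 1"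
    and e: "\<And>z w. eval_expr e (s(-3 := z, r := w)) = v"
  shows "runs (overlap_loop r e) s (2 + 5 * n) (s(-3 := real n, r := s r + v * (\<Sum>u<n. x u * y u)))"
proof -
  define S where "S k = s(-3 := real k, r := s r + v * (\<Sum>u<k. x u * y u))" for k
  let ?X = "Mem (Plus (reg (-4)) (reg (-3)))" and ?Y = "Mem (Plus (reg (-5)) (reg (-3)))"
  let ?body = "Seq (IfLess ?X ?Y (sub_from r e) (IfLess ?Y ?X (sub_from r e) (add_to r e))) (add_to (-3) (Num 1))"
  have "\<exists>s'. runs (WhileLess (reg (-3)) (reg 0) ?body) (S 0) (1 + n * (4 + 1)) s' \<and> s' = S n"
  proof (rule runs_WhileLess)
    fix k t assume k: "k < n" and "t = S k"
    have eX: "eval_expr ?X (S k) = x k"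
    proof -
      have "\<lfloor>real a + real k\<rfloor> = int (a + k)" by linarith
      thus ?thesis using r a k x(1)[OF k] by (simp add: S_def)
    qed
    have eY: "eval_expr ?Y (S k) = y k"
    proof -
      have "\<lfloor>real b + real k\<rfloor> = int (b + k)" by linarith
      thus ?thesis using r b k y(1)[OF k] by (simp add: S_def)
    qed
    have ee: "eval_expr e (S k) = v" by (simp add: S_def e)
    let ?t = "(S k)(r := s r + v * (\<Sum>u<Suc k. x u * y u))"
    have Sr: "S k r = s r + v * (\<Sum>u<k. x u * y u)" by (simp add: S_def)
    have "runs (IfLess ?X ?Y (sub_from r e) (IfLess ?Y ?X (sub_from r e) (add_to r e))) (S k) 3 ?t"
    proof -
      have 1: "?t = (S k)(r := S k r - eval_expr e (S k))" if "x k * y k = -1"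
        using that by (simp add: Sr ee algebra_simps)
      have 2: "?t = (S k)(r := S k r + eval_expr e (S k))" if "x k * y k = 1"
        using that by (simp add: Sr ee algebra_simps)
      consider "x k < y k" "x k * y k = -1" | "\<not> x k < y k" "y k < x k" "x k * y k = -1"
        | "\<not> x k < y k" "\<not> y k < x k" "x k * y k = 1"
      proof -
        have "x k < y k \<and> x k * y k = -1 \<or> \<not> x k < y k \<and> y k < x k \<and> x k * y k = -1
          \<or> \<not> x k < y k \<and> \<not> y k < x k \<and> x k * y k = 1"
          using x(2)[OF k] y(2)[OF k] by (elim disjE) simp_all
        thus thesis using that by blast
      qed
      thus ?thesis
      proof cases
        case 1
        have "runs (sub_from r e) (S k) 1 ?t" unfolding \<open>x k * y k = -1 \<Longrightarrow> ?t = _\<close>[OF 1(2)] by (rule runs_sub_from)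
        thus ?thesis using 1 by (intro runs_mono[OF runs_IfLess, of _ _ _ _ _ 1]) (simp_all add: eX eY del: eval_expr.simps)
      next
        case 2
        have "runs (sub_from r e) (S k) 1 ?t" unfolding \<open>x k * y k = -1 \<Longrightarrow> ?t = _\<close>[OF 2(3)] by (rule runs_sub_from)
        hence "runs (IfLess ?Y ?X (sub_from r e) (add_to r e)) (S k) (Suc 1) ?t"
          using 2 by (intro runs_IfLess) (simp_all add: eX eY del: eval_expr.simps)
        thus ?thesis using 2 by (intro runs_mono[OF runs_IfLess, of _ _ _ _ _ "Suc 1"]) (simp_all add: eX eY del: eval_expr.simps)
      next
        case 3
        have "runs (add_to r e) (S k) 1 ?t" unfolding \<open>x k * y k = 1 \<Longrightarrow> ?t = _\<close>[OF 3(3)] by (rule runs_add_to)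
        hence "runs (IfLess ?Y ?X (sub_from r e) (add_to r e)) (S k) (Suc 1) ?t"
          using 3 by (intro runs_IfLess) (simp_all add: eX eY del: eval_expr.simps)
        thus ?thesis using 3 by (intro runs_mono[OF runs_IfLess, of _ _ _ _ _ "Suc 1"]) (simp_all add: eX eY del: eval_expr.simps)
      qed
    qed
    from runs_Seq[OF this runs_add_to[of "-3" "Num 1"]]
    have "runs ?body (S k) 4 (?t(-3 := ?t (-3) + 1))" by simp
    moreover have "?t(-3 := ?t (-3) + 1) = S (Suc k)"
      using r by (auto simp: S_def fun_eq_iff)
    ultimately show "eval_expr (reg (-3)) t < eval_expr (reg 0) t \<and> (\<exists>s'. runs ?body t 4 s' \<and> s' = S (Suc k))"
      using k n r \<open>t = S k\<close> by (simp add: S_def)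
  next
    show "\<not> eval_expr (reg (-3)) t < eval_expr (reg 0) t" if "t = S n" for t
      using that n r by (simp add: S_def)
  qed simp
  hence "runs (WhileLess (reg (-3)) (reg 0) ?body) (S 0) (1 + n * 5) (S n)" by simp
  moreover have "s(-3 := 0) = S 0" using r by (auto simp: S_def fun_eq_iff)
  hence "runs (Assign (Num (-3)) (Num 0)) s 1 (S 0)"
    using runs_Assign[of "-3" "Num 0" s] by simp
  ultimately have "runs (overlap_loop r e) s (1 + (1 + n * 5)) (S n)"
    unfolding overlap_loop_def by (rule runs_Seq[rotated])
  thus ?thesis by (simp add: S_def mult.commute)
qed

section \<open>Correctness and running time of the program\<close>

definition tester_memory ::
  "memory \<Rightarrow> real \<Rightarrow> real \<Rightarrow> real \<Rightarrow> real \<Rightarrow> real \<Rightarrow> real \<Rightarrow> real \<Rightarrow> memory" where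
  "tester_memory f i j u a b d t = f(-1 := i, -2 := j, -3 := u, -4 := a, -5 := b, -6 := d, -7 := t)"

lemma tester_memory_apply [simp]:
  "tester_memory f i j u a b d t (-1) = i" "tester_memory f i j u a b d t (-2) = j"
  "tester_memory f i j u a b d t (-3) = u" "tester_memory f i j u a b d t (-4) = a"
  "tester_memory f i j u a b d t (-5) = b" "tester_memory f i j u a b d t (-6) = d"
  "tester_memory f i j u a b d t (-7) = t" "0 \<le> k \<Longrightarrow> tester_memory f i j u a b d t k = f k"
  by (auto simp: tester_memory_def)

lemma tester_memory_upd [simp]:
  "(tester_memory f i j u a b d t)(-1 := z) = tester_memory f z j u a b d t"
  "(tester_memory f i j u a b d t)(-2 := z) = tester_memory f i z u a b d t"
  "(tester_memory f i j u a b d t)(-3 := z) = tester_memory f i j z a b d t"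
  "(tester_memory f i j u a b d t)(-4 := z) = tester_memory f i j u z b d t"
  "(tester_memory f i j u a b d t)(-5 := z) = tester_memory f i j u a z d t"
  "(tester_memory f i j u a b d t)(-6 := z) = tester_memory f i j u a b z t"
  "(tester_memory f i j u a b d t)(-7 := z) = tester_memory f i j u a b d z"
  by (auto simp: tester_memory_def fun_eq_iff)

definition overlap :: "nat \<Rightarrow> (nat \<Rightarrow> real) \<Rightarrow> (nat \<Rightarrow> real) \<Rightarrow> real" where
  "overlap n x y = (\<Sum>u<n. x u * y u)"

text \<open>The threshold 4mn is subtracted in portions of \<open>4 * real n\<close>, one per
  sample, as the outer loop does with additions only.\<close>

definition statistic :: "nat \<Rightarrow> nat \<Rightarrow> (nat \<Rightarrow> nat \<Rightarrow> real) \<Rightarrow> real" where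
  "statistic n m X = (\<Sum>i<m. (\<Sum>j<i. (overlap n (X i) (X j))\<^sup>2 - real n) - 4 * real n)"

locale tester_input =
  fixes n m :: nat and f :: memory and X :: "nat \<Rightarrow> nat \<Rightarrow> real"
  assumes f0: "f 0 = real n" and f1: "f 1 = real m"
    and fX: "\<And>i u. i < m \<Longrightarrow> u < n \<Longrightarrow> f (int (4 + i * n + u)) = X i u"
    and spins: "\<And>i u. i < m \<Longrightarrow> u < n \<Longrightarrow> X i u = -1 \<or> X i u = 1"
begin

lemma runs_pair_body:
  assumes i: "i < m" and j: "j < m"
  shows "runs pair_body (tester_memory f i' j' u (real (4 + i * n)) (real (4 + j * n)) d t) (8 + 10 * n)
    (tester_memory f i' (j' + 1) (real n) (real (4 + i * n)) (real (4 + Suc j * n)) (overlap n (X i) (X j))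
       (t + ((overlap n (X i) (X j))\<^sup>2 - real n)))"
proof -
  let ?a = "real (4 + i * n)" and ?b = "real (4 + j * n)" and ?o = "overlap n (X i) (X j)"
  let ?M = "\<lambda>j' u b d t. tester_memory f i' j' u ?a b d t"
  have 1: "runs (Assign (Num (-6)) (Num 0)) (?M j' u ?b d t) 1 (?M j' u ?b 0 t)"
    using runs_Assign[of "-6" "Num 0" "?M j' u ?b d t"] by simp
  have 2: "runs (overlap_loop (-6) (Num 1)) (?M j' u ?b 0 t) (2 + 5 * n) (?M j' (real n) ?b ?o t)"
    using runs_overlap_loop[of "-6" "?M j' u ?b 0 t" n "4 + i * n" "4 + j * n" "X i" "X j" "Num 1" 1]
      f0 fX[OF i] fX[OF j] spins[OF i] spins[OF j] by (simp add: overlap_def)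
  have 3: "runs (overlap_loop (-7) (reg (-6))) (?M j' (real n) ?b ?o t) (2 + 5 * n) (?M j' (real n) ?b ?o (t + ?o * ?o))"
    using runs_overlap_loop[of "-7" "?M j' (real n) ?b ?o t" n "4 + i * n" "4 + j * n" "X i" "X j" "reg (-6)" ?o]
      f0 fX[OF i] fX[OF j] spins[OF i] spins[OF j] by (simp add: overlap_def)
  have 4: "runs (sub_from (-7) (reg 0)) (?M j' (real n) ?b ?o (t + ?o * ?o)) 1 (?M j' (real n) ?b ?o (t + ?o * ?o - real n))"
    using runs_sub_from[of "-7" "reg 0" "?M j' (real n) ?b ?o (t + ?o * ?o)"] f0 by simp
  have 5: "runs (add_to (-2) (Num 1)) (?M j' (real n) ?b ?o (t + ?o * ?o - real n)) 1 (?M (j' + 1) (real n) ?b ?o (t + ?o * ?o - real n))"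
    using runs_add_to[of "-2" "Num 1" "?M j' (real n) ?b ?o (t + ?o * ?o - real n)"] by simp
  have 6: "runs (add_to (-5) (reg 0)) (?M (j' + 1) (real n) ?b ?o (t + ?o * ?o - real n)) 1
      (?M (j' + 1) (real n) (?b + real n) ?o (t + ?o * ?o - real n))"
    using runs_add_to[of "-5" "reg 0" "?M (j' + 1) (real n) ?b ?o (t + ?o * ?o - real n)"] f0 by simp
  have "runs pair_body (?M j' u ?b d t) (1 + ((2 + 5 * n) + ((2 + 5 * n) + (1 + (1 + 1)))))
      (?M (j' + 1) (real n) (?b + real n) ?o (t + ?o * ?o - real n))"
    unfolding pair_body_def by (rule runs_Seq[OF 1 runs_Seq[OF 2 runs_Seq[OF 3 runs_Seq[OF 4 runs_Seq[OF 5 6]]]]])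
  moreover have "?b + real n = real (4 + Suc j * n)" by simp
  moreover have "t + ?o * ?o - real n = t + (?o\<^sup>2 - real n)" by (simp add: power2_eq_square)
  moreover have "1 + ((2 + 5 * n) + ((2 + 5 * n) + (1 + (1 + 1)))) = 8 + 10 * n" by simp
  ultimately show ?thesis by (simp only:)
qed

lemma runs_sample_body:
  assumes i: "i < m"
  shows "\<exists>j' u' b' d'. runs sample_body (tester_memory f (real i) j u (real (4 + i * n)) b d t) (6 + m * (9 + 10 * n))
    (tester_memory f (real (Suc i)) j' u' (real (4 + Suc i * n)) b' d'
       (t + ((\<Sum>j<i. (overlap n (X i) (X j))\<^sup>2 - real n) - 4 * real n)))"
proof -
  let ?a = "real (4 + i * n)" and ?t = "t - 4 * real n"
  let ?M = "\<lambda>j u b d t. tester_memory f (real i) j u ?a b d t"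
  let ?S = "\<lambda>j. \<Sum>j<j. (overlap n (X i) (X j))\<^sup>2 - real n"
  define P where "P j s \<longleftrightarrow> (\<exists>u d. s = ?M (real j) u (real (4 + j * n)) d (?t + ?S j))" for j s
  have 1: "runs (Assign (Num (-2)) (Num 0)) (?M j u b d t) 1 (?M 0 u b d t)"
    using runs_Assign[of "-2" "Num 0" "?M j u b d t"] by simp
  have 2: "runs (Assign (Num (-5)) (Num 4)) (?M 0 u b d t) 1 (?M 0 u 4 d t)"
    using runs_Assign[of "-5" "Num 4" "?M 0 u b d t"] by simp
  have 3: "runs (sub_from (-7) (Plus (Plus (reg 0) (reg 0)) (Plus (reg 0) (reg 0)))) (?M 0 u 4 d t) 1 (?M 0 u 4 d ?t)"
    using runs_sub_from[of "-7" "Plus (Plus (reg 0) (reg 0)) (Plus (reg 0) (reg 0))" "?M 0 u 4 d t"] f0 by simp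
  have "\<exists>s'. runs (WhileLess (reg (-2)) (reg (-1)) pair_body) (?M 0 u 4 d ?t) (1 + i * (8 + 10 * n + 1)) s' \<and> P i s'"
  proof (rule runs_WhileLess)
    fix k s assume k: "k < i" and "P k s"
    then obtain u d where s: "s = ?M (real k) u (real (4 + k * n)) d (?t + ?S k)" by (auto simp: P_def)
    have "k < m" using i k by simp
    have "?M (real k + 1) (real n) (real (4 + Suc k * n)) (overlap n (X i) (X k)) (?t + ?S k + ((overlap n (X i) (X k))\<^sup>2 - real n))
       = ?M (real (Suc k)) (real n) (real (4 + Suc k * n)) (overlap n (X i) (X k)) (?t + ?S (Suc k))"
      by (simp add: add.commute[of 1 "real k"])
    hence "P (Suc k) (?M (real k + 1) (real n) (real (4 + Suc k * n)) (overlap n (X i) (X k)) (?t + ?S k + ((overlap n (X i) (X k))\<^sup>2 - real n)))"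
      unfolding P_def by blast
    thus "eval_expr (reg (-2)) s < eval_expr (reg (-1)) s \<and> (\<exists>s'. runs pair_body s (8 + 10 * n) s' \<and> P (Suc k) s')"
      using runs_pair_body[OF i \<open>k < m\<close>, of "real i" "real k" u d "?t + ?S k"] k unfolding s by (auto simp del: of_nat_add of_nat_mult)
  next
    show "\<not> eval_expr (reg (-2)) s < eval_expr (reg (-1)) s" if "P i s" for s
      using that by (auto simp: P_def)
    show "P 0 (?M 0 u 4 d ?t)" unfolding P_def by auto
  qed
  then obtain u' d' where 4: "runs (WhileLess (reg (-2)) (reg (-1)) pair_body) (?M 0 u 4 d ?t) (1 + i * (8 + 10 * n + 1))
      (?M (real i) u' (real (4 + i * n)) d' (?t + ?S i))"
    unfolding P_def by blast
  let ?s = "?M (real i) u' (real (4 + i * n)) d' (?t + ?S i)"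
  have 5: "runs (add_to (-1) (Num 1)) ?s 1 (?s(-1 := real i + 1))"
    using runs_add_to[of "-1" "Num 1" ?s] by simp
  have 6: "runs (add_to (-4) (reg 0)) (?s(-1 := real i + 1)) 1 (?s(-1 := real i + 1, -4 := ?a + real n))"
    using runs_add_to[of "-4" "reg 0" "?s(-1 := real i + 1)"] f0 by simp
  have "runs sample_body (?M j u b d t) (1 + (1 + (1 + ((1 + i * (8 + 10 * n + 1)) + (1 + 1)))))
     (?s(-1 := real i + 1, -4 := ?a + real n))"
    unfolding sample_body_def by (rule runs_Seq[OF 1 runs_Seq[OF 2 runs_Seq[OF 3 runs_Seq[OF 4 runs_Seq[OF 5 6]]]]])
  \<comment> \<open>\<open>i\<close> is replaced by \<open>m\<close> because the rule for the outer
    loop asks for one bound for all rounds.\<close>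
  moreover have "1 + (1 + (1 + ((1 + i * (8 + 10 * n + 1)) + (1 + 1)))) \<le> 6 + m * (9 + 10 * n)"
    using mult_right_mono[of i m "9 + 10 * n"] i by simp
  moreover have "?s(-1 := real i + 1, -4 := ?a + real n) = tester_memory f (real (Suc i)) (real i) u' (real (4 + Suc i * n))
      (real (4 + i * n)) d' (t + (?S i - 4 * real n))"
    by (simp add: algebra_simps)
  ultimately have "runs sample_body (?M j u b d t) (6 + m * (9 + 10 * n)) (tester_memory f (real (Suc i)) (real i) u'
      (real (4 + Suc i * n)) (real (4 + i * n)) d' (t + (?S i - 4 * real n)))"
    by (simp only: runs_mono)
  thus ?thesis by blast
qed

lemma runs_tester:
  assumes "f (-1) = 0" "f (-7) = 0"
  shows "\<exists>s'. runs tester f (4 + m * (7 + m * (9 + 10 * n))) s' \<and> s' 0 = (if 0 < statistic n m X then 0 else 1)"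
proof -
  define P where "P i s \<longleftrightarrow> (\<exists>j u b d. s = tester_memory f (real i) j u (real (4 + i * n)) b d (statistic n i X))" for i s
  have 1: "runs (Assign (Num (-4)) (Num 4)) f 1 (f(-4 := 4))"
    using runs_Assign[of "-4" "Num 4" f] by simp
  have "\<exists>s'. runs (WhileLess (reg (-1)) (reg 1) sample_body) (f(-4 := 4)) (1 + m * (6 + m * (9 + 10 * n) + 1)) s' \<and> P m s'"
  proof (rule runs_WhileLess)
    fix k s assume k: "k < m" and "P k s"
    then obtain j u b d where s: "s = tester_memory f (real k) j u (real (4 + k * n)) b d (statistic n k X)"
      by (auto simp: P_def)
    have "statistic n (Suc k) X = statistic n k X + ((\<Sum>j<k. (overlap n (X k) (X j))\<^sup>2 - real n) - 4 * real n)"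
      by (simp add: statistic_def)
    hence "\<exists>s'. runs sample_body s (6 + m * (9 + 10 * n)) s' \<and> P (Suc k) s'"
      using runs_sample_body[OF k, of j u b d "statistic n k X"] unfolding s P_def by metis
    moreover have "eval_expr (reg (-1)) s < eval_expr (reg 1) s" using k f1 by (simp add: s)
    ultimately show "eval_expr (reg (-1)) s < eval_expr (reg 1) s \<and>
        (\<exists>s'. runs sample_body s (6 + m * (9 + 10 * n)) s' \<and> P (Suc k) s')" by blast
  next
    show "\<not> eval_expr (reg (-1)) s < eval_expr (reg 1) s" if "P m s" for s
      using that f1 by (auto simp: P_def)
    \<comment> \<open>The outer counter and the statistic start from the zeros that the input leaves
      at negative addresses.\<close>
    have "f(-4 := 4) = tester_memory f (real 0) (f (-2)) (f (-3)) (real (4 + 0 * n)) (f (-5)) (f (-6)) (statistic n 0 X)"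
      using assms by (auto simp: tester_memory_def statistic_def fun_eq_iff)
    thus "P 0 (f(-4 := 4))" unfolding P_def by blast
  qed
  then obtain s where s: "runs (WhileLess (reg (-1)) (reg 1) sample_body) (f(-4 := 4)) (1 + m * (6 + m * (9 + 10 * n) + 1)) s"
    "s (-7) = statistic n m X" unfolding P_def by fastforce
  let ?v = "if 0 < statistic n m X then 0 else 1 :: int"
  have "runs (IfLess (Num 0) (reg (-7)) (Assign (Num 0) (Num 0)) (Assign (Num 0) (Num 1))) s (Suc 1) (s(0 := of_int ?v))"
    using runs_Assign[of 0 "Num 0" s] runs_Assign[of 0 "Num 1" s] s(2) by (intro runs_IfLess) auto
  from runs_Seq[OF 1 runs_Seq[OF s(1) this]]
  have "runs tester f (4 + m * (7 + m * (9 + 10 * n))) (s(0 := of_int ?v))"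
    unfolding tester_def by (rule runs_mono) simp
  thus ?thesis by (intro exI[of _ "s(0 := of_int ?v)"]) auto
qed

end

lemma tester_input_input:
  assumes "\<And>i. i < m \<Longrightarrow> X i \<in> spin_configs n"
  shows "tester_input n m (input n m \<beta> \<epsilon> X) X"
proof
  fix i u assume iu: "i < m" "u < n"
  have "i * n + u < Suc i * n" using iu by simp
  also have "\<dots> \<le> m * n" using iu by (intro mult_right_mono) auto
  finally have "i * n + u < m * n" .
  hence "int i * int n + int u < int m * int n" by (metis of_nat_add of_nat_less_iff of_nat_mult)
  moreover have "nat (int i * int n + int u) = i * n + u" by (metis nat_int of_nat_add of_nat_mult)
  moreover have "0 \<le> int i * int n" by simp
  ultimately show "input n m \<beta> \<epsilon> X (int (4 + i * n + u)) = X i u"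
    using iu by (auto simp: input_def)
  show "X i u = -1 \<or> X i u = 1" using assms[OF iu(1)] iu(2) by (auto simp: spin_configs_def PiE_dflt_def)
qed (auto simp: input_def)

lemma tester_halts:
  assumes "\<And>i. i < m \<Longrightarrow> X i \<in> spin_configs n"
  shows "\<exists>t s'. exec tester (input n m \<beta> \<epsilon> X) t s' \<and> t \<le> 4 + m * (7 + m * (9 + 10 * n)) \<and>
    s' 0 = (if 0 < statistic n m X then 0 else 1)"
proof -
  interpret tester_input n m "input n m \<beta> \<epsilon> X" X using assms by (rule tester_input_input)
  have "input n m \<beta> \<epsilon> X (-1) = 0" "input n m \<beta> \<epsilon> X (-7) = 0" by (auto simp: input_def)
  thus ?thesis using runs_tester unfolding runs_def by blast
qed

lemma polynomial_time_tester: "polynomial_time tester"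
  unfolding polynomial_time_def
\<comment> \<open>30 = 4 + 7 + 9 + 10 adds the coefficients of the step bound, each monomial of
  which is at most \<open>(n + m) ^ 3\<close>.\<close>
proof (rule exI[of _ 30], rule exI[of _ 3], intro allI impI)
  fix n m :: nat and \<beta> \<epsilon> :: real and X :: "nat \<Rightarrow> nat \<Rightarrow> real"
  assume n: "1 \<le> n" and X: "\<forall>i<m. X i \<in> spin_configs n"
  let ?N = "n + m"
  have "4 + m * (7 + m * (9 + 10 * n)) \<le> 4 * (?N * (?N * ?N)) + ?N * (7 * (?N * ?N) + ?N * (9 * ?N + 10 * ?N))"
  proof (intro add_mono mult_mono)
    show "4 \<le> 4 * (?N * (?N * ?N))" "7 \<le> 7 * (?N * ?N)" "9 \<le> 9 * ?N" using n by (auto simp: Suc_le_eq)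
  qed auto
  also have "\<dots> = 30 * ?N ^ 3" by (simp add: power3_eq_cube)
  finally have "4 + m * (7 + m * (9 + 10 * n)) \<le> 30 * ?N ^ 3" .
  thus "\<exists>t s'. exec tester (input n m \<beta> \<epsilon> X) t s' \<and> t \<le> 30 * (n + m) ^ 3"
    using tester_halts[of m X n \<beta> \<epsilon>] X by (meson order_trans)
qed

lemma answers_tester:
  assumes "\<And>i. i < m \<Longrightarrow> X i \<in> spin_configs n"
  shows "answers tester (input n m \<beta> \<epsilon> X) (if 0 < statistic n m X then Far else Product)"
  using tester_halts[of m X n \<beta> \<epsilon>] assms unfolding answers_def by (auto split: if_splits)

section \<open>Product measures among Ising models\<close>

lemma uniform_ising: "ising_pmf n (\<lambda>_. 0) (\<lambda>_ _. 0) = pmf_of_set (spin_configs n)"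
  by (rule pmf_eqI) (simp add: pmf_ising ising_weight_def indicator_def)

lemma uniform_product: "pmf_of_set (spin_configs n) = Pi_pmf {..<n} 0 (\<lambda>_. pmf_of_set {-1, 1})"
  unfolding spin_configs_def by (rule Pi_pmf_of_set[symmetric]) auto

lemma uniform_in_product_pmfs: "ising_pmf n (\<lambda>_. 0) (\<lambda>_ _. 0) \<in> product_pmfs n"
  unfolding uniform_ising uniform_product product_pmfs_def by auto

text \<open>Without external field the distribution is invariant under the global spin flip, which forces all
  marginals to be uniform.\<close>

lemma product_ising_uniform:
  assumes "ising_pmf n (\<lambda>_. 0) \<theta> \<in> product_pmfs n"
  shows "ising_pmf n (\<lambda>_. 0) \<theta> = ising_pmf n (\<lambda>_. 0) (\<lambda>_ _. 0)"
proof -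
  let ?p = "ising_pmf n (\<lambda>_. 0) \<theta>" and ?neg = "\<lambda>x v. - x v :: real"
  obtain q where p: "?p = Pi_pmf {..<n} 0 q" and q: "\<And>v. v < n \<Longrightarrow> set_pmf (q v) \<subseteq> {-1, 1}"
    using assms by (auto simp: product_pmfs_def)
  have inj: "inj ?neg" by (auto simp: inj_def fun_eq_iff)
  have flip: "map_pmf ?neg ?p = ?p"
  proof (rule pmf_eqI)
    fix x
    have "pmf (map_pmf ?neg ?p) (?neg (?neg x)) = pmf ?p (?neg x)" by (rule pmf_map_inj'[OF inj])
    moreover have "?neg x \<in> spin_configs n \<longleftrightarrow> x \<in> spin_configs n"
      using spin_configs_uminus[of x n] spin_configs_uminus[of "?neg x" n] by auto
    ultimately show "pmf (map_pmf ?neg ?p) x = pmf ?p x"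
      by (simp add: pmf_ising ising_weight_def)
  qed
  have "q v = pmf_of_set {-1, 1}" if v: "v < n" for v
  proof -
    have marg: "map_pmf (\<lambda>x. x v) ?p = q v" using v by (simp add: p Pi_pmf_component)
    have "map_pmf uminus (q v) = map_pmf (\<lambda>x. x v) (map_pmf ?neg ?p)"
      unfolding marg[symmetric] by (simp add: map_pmf_comp)
    also have "\<dots> = q v" by (simp add: flip marg)
    finally have "pmf (q v) 1 = pmf (q v) (-1)"
      using pmf_map_inj'[of "uminus :: real \<Rightarrow> real" "q v" 1] by simp
    moreover have "(\<Sum>x\<in>{-1, 1}. pmf (q v) x) = 1"
      using q[OF v] by (intro sum_pmf_eq_1) auto
    ultimately have half: "pmf (q v) 1 = 1 / 2" "pmf (q v) (-1) = 1 / 2" by auto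
    show ?thesis
    proof (rule pmf_eqI)
      fix x
      show "pmf (q v) x = pmf (pmf_of_set {-1, 1}) x"
        using half q[OF v] by (cases "x = 1 \<or> x = -1") (auto simp: set_pmf_iff)
    qed
  qed
  hence "?p = Pi_pmf {..<n} 0 (\<lambda>_. pmf_of_set {-1, 1})"
    unfolding p by (intro Pi_pmf_cong) auto
  thus ?thesis by (simp add: uniform_ising uniform_product)
qed

text \<open>Without interaction all influences vanish, so the Poincare constant is 1 whatever the
  given \<eta> is.\<close>

lemma ising_uniform:
  assumes "0 < n"
  shows "ising n (\<lambda>_ _. 0) 1"
proof
  show "high_temperature n 1 (\<lambda>_ _. 0)"
    unfolding high_temperature_def using assms by (subst Max_le_iff) auto
qed (use assms in auto)

lemma mean_pair_uniform:
  assumes "0 < n" "u < n" "v < n" "u \<noteq> v"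
  shows "spin_measure.mean n (pmf (ising_pmf n (\<lambda>_. 0) (\<lambda>_ _. 0))) (\<lambda>x. x u * x v) = 0"
proof -
  interpret U: ising n "\<lambda>_ _. 0" 1 by (rule ising_uniform[OF assms(1)])
  show ?thesis
    unfolding U.mean_split[OF assms(3)] using assms
    by (simp add: uniform_ising spin_configs_upd indicator_def)
qed

lemma corr_norm_uniform:
  assumes "0 < n"
  shows "ising.corr_norm n (\<lambda>_ _. 0) = 0"
proof -
  interpret U: ising n "\<lambda>_ _. 0" 1 by (rule ising_uniform[OF assms])
  show ?thesis
    unfolding U.corr_norm_def using mean_pair_uniform[OF assms]
    by (intro sum.neutral ballI) (auto simp: U.corr_def)
qed

section \<open>From the symmetrised divergence to the correlations\<close>

context ising
begin

text \<open>Up to a constant the log-likelihood ratio is the energy \<open>H\<close>. The two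
  divergences contain that constant with opposite signs, so the partition function cancels, and
  \<open>H\<close> has mean 0 under the uniform measure.\<close>

lemma skl_div_uniform:
  "skl_div model (ising_pmf n (\<lambda>_. 0) (\<lambda>_ _. 0)) = ereal (\<Sum>v<n. \<Sum>u<v. \<theta> u v * corr u v)"
proof -
  interpret U: ising n "\<lambda>_ _. 0" 1 by (rule ising_uniform[OF n_pos])
  define H where "H x = (\<Sum>v<n. \<Sum>u<v. \<theta> u v * (x u * x v))" for x :: "nat \<Rightarrow> real"
  define Z where "Z = (\<Sum>y\<in>spin_configs n. ising_weight n (\<lambda>_. 0) \<theta> y)"
  define q where "q = 1 / real (card (spin_configs n))"
  let ?S = "spin_configs n" and ?p = "pmf model" and ?q = "pmf U.model"
  have Z: "Z > 0" unfolding Z_def by (intro sum_pos) (auto simp: ising_weight_def)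
  have q: "q > 0" by (auto simp: q_def card_gt_0_iff)
  have px: "?p x = exp (H x) / Z" if "x \<in> ?S" for x
    using that by (simp add: pmf_ising Z_def ising_weight_def H_def mult.assoc)
  have qx: "?q x = q" if "x \<in> ?S" for x
    using that by (simp add: uniform_ising q_def)
  have mU: "U.mean H = 0"
    unfolding H_def U.mean_sum U.mean_cmult
    by (intro sum.neutral ballI) (auto simp: mean_pair_uniform[OF n_pos])
  have mp: "mean H = (\<Sum>v<n. \<Sum>u<v. \<theta> u v * corr u v)"
    unfolding H_def mean_sum mean_cmult by (intro sum.cong) (auto simp: corr_def)
  have "skl_div model U.model = ereal ((\<Sum>x\<in>?S. ?p x * ln (?p x / ?q x)) + (\<Sum>x\<in>?S. ?q x * ln (?q x / ?p x)))"
    by (simp add: skl_div_def kl_div_finite set_pmf_model U.set_pmf_model)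
  also have "(\<Sum>x\<in>?S. ?p x * ln (?p x / ?q x)) = mean (\<lambda>x. H x - ln (Z * q))"
    unfolding mean_def using Z q by (intro sum.cong refl) (simp add: px qx ln_div ln_mult)
  also have "(\<Sum>x\<in>?S. ?q x * ln (?q x / ?p x)) = U.mean (\<lambda>x. ln (Z * q) - H x)"
    unfolding U.mean_def using Z q by (intro sum.cong refl) (simp add: px qx ln_div ln_mult)
  finally show ?thesis by (simp add: mean_diff U.mean_diff mU mp)
qed

text \<open>Being one of the product measures, the uniform one is at least as far away as the
  nearest of them. Cauchy-Schwarz runs over all ordered pairs, which count every edge twice; hence
  the factor 4.\<close>

lemma far_corr_norm:
  assumes far: "ereal \<epsilon> \<le> skl_dist model (product_pmfs n)" and \<epsilon>: "0 < \<epsilon>"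
    and \<beta>: "\<And>u v. u < n \<Longrightarrow> v < n \<Longrightarrow> u \<noteq> v \<Longrightarrow> \<bar>\<theta> u v\<bar> \<le> \<beta>"
  shows "4 * \<epsilon>\<^sup>2 \<le> \<beta>\<^sup>2 * (real n)\<^sup>2 * corr_norm"
proof -
  let ?T = "\<Sum>u<n. \<Sum>v<n. \<bar>corr u v\<bar>"
  have "skl_dist model (product_pmfs n) \<le> skl_div model (ising_pmf n (\<lambda>_. 0) (\<lambda>_ _. 0))"
    unfolding skl_dist_def by (rule INF_lower[OF uniform_in_product_pmfs])
  hence "ereal \<epsilon> \<le> ereal (\<Sum>v<n. \<Sum>u<v. \<theta> u v * corr u v)"
    unfolding skl_div_uniform by (rule order_trans[OF far])
  hence "\<epsilon> \<le> (\<Sum>v<n. \<Sum>u<v. \<theta> u v * corr u v)" by simp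
  also have "\<dots> \<le> (\<Sum>v<n. \<Sum>u<v. \<beta> * \<bar>corr u v\<bar>)"
  proof (intro sum_mono)
    fix u v assume "v \<in> {..<n}" "u \<in> {..<v}"
    hence "\<bar>\<theta> u v\<bar> * \<bar>corr u v\<bar> \<le> \<beta> * \<bar>corr u v\<bar>" by (intro mult_right_mono \<beta>) auto
    thus "\<theta> u v * corr u v \<le> \<beta> * \<bar>corr u v\<bar>" using abs_ge_self[of "\<theta> u v * corr u v"] by (simp add: abs_mult)
  qed
  finally have "\<epsilon> \<le> \<beta> * (\<Sum>v<n. \<Sum>u<v. \<bar>corr u v\<bar>)" by (simp only: sum_distrib_left)
  hence "2 * \<epsilon> \<le> \<beta> * (2 * (\<Sum>v<n. \<Sum>u<v. \<bar>corr u v\<bar>))" by simp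
  also have "2 * (\<Sum>v<n. \<Sum>u<v. \<bar>corr u v\<bar>) = ?T"
    by (rule sum_symmetric_pairs[symmetric]) (auto simp: corr_sym, simp add: corr_def)
  finally have "(2 * \<epsilon>)\<^sup>2 \<le> (\<beta> * ?T)\<^sup>2" using \<epsilon> by (intro power_mono) auto
  moreover have "?T\<^sup>2 \<le> (real n)\<^sup>2 * corr_norm"
  proof -
    let ?A = "{..<n} \<times> {..<n}"
    have "(\<Sum>z\<in>?A. 1 * \<bar>case z of (u, v) \<Rightarrow> corr u v\<bar>)\<^sup>2 \<le> (\<Sum>z\<in>?A. 1\<^sup>2) * (\<Sum>z\<in>?A. \<bar>case z of (u, v) \<Rightarrow> corr u v\<bar>\<^sup>2)"
      by (rule Cauchy_Schwarz_ineq_sum)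
    thus ?thesis
      by (simp add: corr_norm_def sum.cartesian_product case_prod_unfold power2_eq_square)
  qed
  hence "\<beta>\<^sup>2 * ?T\<^sup>2 \<le> \<beta>\<^sup>2 * ((real n)\<^sup>2 * corr_norm)" by (intro mult_left_mono) auto
  ultimately show ?thesis by (simp add: power_mult_distrib)
qed

section \<open>Error probabilities of the test\<close>

text \<open>The default sample is that of \<open>answer_prob\<close>, so that
  \<open>samples m\<close> is the distribution used there.\<close>

sublocale iid_samples model "\<lambda>_. 0"
  by standard (simp add: set_pmf_model)

lemma E_eq_mean: "E f = mean f"
  unfolding mean_def by (subst integral_measure_pmf[of "spin_configs n"]) (auto simp: set_pmf_model)

definition U_stat :: "nat \<Rightarrow> (nat \<Rightarrow> nat \<Rightarrow> real) \<Rightarrow> real" where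
  "U_stat m X = (\<Sum>i<m. \<Sum>j<i. overlap_kernel n (X i) (X j))"

lemma U_stat_variance:
  "ES m (\<lambda>X. (U_stat m X - real m * (real m - 1) / 2 * corr_norm)\<^sup>2) \<le>
    2 * real m ^ 3 * (4 * corr_norm / \<eta>\<^sup>2) + (real m)\<^sup>2 * (4 * (real n)\<^sup>2 / \<eta>\<^sup>2 + 4 * corr_norm / \<eta>\<^sup>2)"
proof -
  have "mean (\<lambda>y. mean (\<lambda>x. overlap_kernel n x y)) = mean (quad_form n corr)"
    by (rule mean_cong) (rule mean_overlap_kernel)
  hence s: "mean (\<lambda>y. mean (\<lambda>x. overlap_kernel n x y)) = corr_norm" by (simp only: mean_quad_form_corr)
  have "mean (\<lambda>y. (mean (\<lambda>x. overlap_kernel n x y) - corr_norm)\<^sup>2) = mean (\<lambda>y. (quad_form n corr y - corr_norm)\<^sup>2)"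
    by (rule mean_cong) (simp add: mean_overlap_kernel)
  hence g: "mean (\<lambda>y. (mean (\<lambda>x. overlap_kernel n x y) - corr_norm)\<^sup>2) \<le> 4 * corr_norm / \<eta>\<^sup>2"
    using variance_quad_form_corr by simp
  have "ES m (\<lambda>X. (U_stat m X - real m * (real m - 1) / 2 * corr_norm)\<^sup>2) \<le>
    2 * real m ^ 3 * mean (\<lambda>y. (mean (\<lambda>x. overlap_kernel n x y) - corr_norm)\<^sup>2)
      + (real m)\<^sup>2 * mean (\<lambda>y. mean (\<lambda>x. (overlap_kernel n x y - corr_norm)\<^sup>2))"
    using U_statistic_variance[of "overlap_kernel n" m, OF overlap_kernel_sym]
    unfolding E_eq_mean s U_stat_def .
  also have "\<dots> \<le> 2 * real m ^ 3 * (4 * corr_norm / \<eta>\<^sup>2) + (real m)\<^sup>2 * (4 * (real n)\<^sup>2 / \<eta>\<^sup>2 + 4 * corr_norm / \<eta>\<^sup>2)"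
    by (intro add_mono mult_left_mono g variance_overlap_kernel) auto
  finally show ?thesis .
qed

lemma statistic_eq: "statistic n m X = U_stat m X - 4 * real m * real n"
  by (simp add: statistic_def U_stat_def overlap_kernel_def overlap_def sum_subtractf)

lemma answer_prob_tester:
  assumes "measure_pmf.prob (samples m) {X. (0 < statistic n m X) \<noteq> (b = Far)} \<le> 1 / 3"
  shows "answer_prob tester n m \<beta> \<epsilon> model b \<ge> 2 / 3"
proof -
  let ?B = "{X. (0 < statistic n m X) \<noteq> (b = Far)}"
  have "measure_pmf.prob (samples m) (- ?B) \<le> answer_prob tester n m \<beta> \<epsilon> model b"
    unfolding answer_prob_def
  proof (rule measure_pmf.finite_measure_mono_AE)
    show "AE X in measure_pmf (samples m). X \<in> - ?B \<longrightarrow> X \<in> {X. answers tester (input n m \<beta> \<epsilon> X) b}"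
      unfolding AE_measure_pmf_iff
    proof (intro ballI impI)
      fix X assume X: "X \<in> set_pmf (samples m)" and B: "X \<in> - ?B"
      have "X i \<in> spin_configs n" if "i < m" for i
        using X that by (auto simp: set_Pi_pmf set_pmf_model PiE_dflt_def)
      from answers_tester[of m X n \<beta> \<epsilon>, OF this] B
      show "X \<in> {X. answers tester (input n m \<beta> \<epsilon> X) b}"
        by (cases b) (auto split: if_splits)
    qed
  qed simp
  moreover have "measure_pmf.prob (samples m) (- ?B) = 1 - measure_pmf.prob (samples m) ?B"
    using measure_pmf.prob_compl[of ?B "samples m"] by (simp add: Compl_eq_Diff_UNIV)
  ultimately show ?thesis using assms by simp
qed

text \<open>Here the variance is at most 4(mn)^2, and the threshold 4mn makes Chebyshev's bound 4/16
  for every \<open>m > 0\<close>. Without samples the statistic is 0, which also yields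
  \<open>Product\<close>.\<close>

lemma answer_prob_product:
  assumes "corr_norm = 0" and \<eta>: "\<eta> = 1"
  shows "answer_prob tester n m \<beta> \<epsilon> model Product \<ge> 2 / 3"
proof (rule answer_prob_tester)
  have sub: "{X. (0 < statistic n m X) \<noteq> (Product = Far)} = {X. 4 * real m * real n < U_stat m X}"
    by (auto simp: statistic_eq)
  show "measure_pmf.prob (samples m) {X. (0 < statistic n m X) \<noteq> (Product = Far)} \<le> 1 / 3"
  proof (cases "m = 0")
    case True
    thus ?thesis unfolding sub by (simp add: U_stat_def)
  next
    case False
    hence a: "4 * real m * real n > 0" using n_pos by simp
    have "measure_pmf.prob (samples m) {X. 4 * real m * real n < U_stat m X} \<le>
        measure_pmf.prob (samples m) {X. 4 * real m * real n \<le> \<bar>U_stat m X\<bar>}"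
      by (intro measure_pmf.finite_measure_mono) auto
    also have "\<dots> \<le> ES m (\<lambda>X. (U_stat m X)\<^sup>2) / (4 * real m * real n)\<^sup>2"
      by (rule prob_square_ge[OF a])
    also have "\<dots> \<le> ((real m)\<^sup>2 * (4 * (real n)\<^sup>2)) / (4 * real m * real n)\<^sup>2"
      using U_stat_variance[of m] assms by (intro divide_right_mono) auto
    also have "\<dots> = 1 / 4" using False n_pos by (simp add: power2_eq_square)
    finally show ?thesis unfolding sub by simp
  qed
qed

text \<open>Chebyshev around the mean \<open>\<mu>\<close>: a wrong answer is a deviation of at
  least \<open>\<mu> / 2\<close> once the threshold is below \<open>\<mu> / 2\<close>, so the
  variance has to be at most \<open>\<mu>\<^sup>2 / 12\<close>.\<close>

lemma answer_prob_far:
  assumes ms: "4000 / \<eta>\<^sup>2 * real n \<le> real m * corr_norm"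
  shows "answer_prob tester n m \<beta> \<epsilon> model Far \<ge> 2 / 3"
proof (rule answer_prob_tester)
  let ?s = corr_norm
  define M where "M = real m"
  have eta1: "\<eta>\<^sup>2 \<le> 1" "0 < \<eta>\<^sup>2" using eta_pos \<eta>_le_1 by (auto simp: power_le_one)
  have n1: "1 \<le> real n" using n_pos by simp
  have Ms: "4000 * real n \<le> \<eta>\<^sup>2 * (M * ?s)"
    using ms eta1 by (simp add: field_simps M_def)
  have Ms_pos: "0 < M * ?s" 
    using Ms n1 eta1 by (smt (verit) mult_le_0_iff)
  hence M0: "0 < M" and s0: "0 < ?s" using corr_norm_nonneg by (auto simp: zero_less_mult_iff M_def)
  have Ms': "4000 * real n \<le> M * ?s"
    using Ms mult_right_mono[OF eta1(1), of "M * ?s"] Ms_pos by simp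
  \<comment> \<open>As \<open>corr_norm\<close> is at most \<open>n / \<eta>\<close>, a large
    product with \<open>M\<close> forces \<open>M\<close> itself to be large. Then
    \<open>M - 1\<close> is at least \<open>M / 2\<close>.\<close>
  have M2: "2 \<le> M"
  proof -
    have "4000 * real n \<le> \<eta>\<^sup>2 * (M * (real n / \<eta>))"
      using Ms mult_left_mono[OF mult_left_mono[OF corr_norm_le, of M], of "\<eta>\<^sup>2"] M0 by simp
    also have "\<dots> = \<eta> * M * real n" using eta_pos by (simp add: power2_eq_square)
    finally have "4000 \<le> \<eta> * M" using n1 by simp
    also have "\<dots> \<le> 1 * M" using \<eta>_le_1 M0 by (intro mult_right_mono) auto
    finally show ?thesis by simp
  qed
  define \<mu> where "\<mu> = M * (M - 1) / 2 * ?s"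
  have \<mu>: "M * (M * ?s) / 4 \<le> \<mu>"
  proof -
    have "M * ?s * (M / 2) \<le> M * ?s * (M - 1)" using M2 Ms_pos by (intro mult_left_mono) auto
    thus ?thesis by (simp add: \<mu>_def algebra_simps)
  qed
  have "M * (4000 * real n) \<le> M * (M * ?s)" using Ms' M0 by (intro mult_left_mono) auto
  moreover have "M * (4000 * real n) = 4000 * (M * real n)" "4 * M * real n = 4 * (M * real n)" "0 \<le> M * real n"
    using M0 by auto
  ultimately have thr: "4 * M * real n \<le> \<mu> / 2" using \<mu> by linarith
  have \<mu>0: "0 < \<mu> / 2" using thr M0 n1 by (smt (verit) mult_pos_pos)
  have "measure_pmf.prob (samples m) {X. (0 < statistic n m X) \<noteq> (Far = Far)} \<le>
      measure_pmf.prob (samples m) {X. \<mu> / 2 \<le> \<bar>U_stat m X - \<mu>\<bar>}"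
    using thr \<mu>0 by (intro measure_pmf.finite_measure_mono) (auto simp: statistic_eq M_def)
  also have "\<dots> \<le> ES m (\<lambda>X. (U_stat m X - \<mu>)\<^sup>2) / (\<mu> / 2)\<^sup>2"
    by (rule prob_square_ge[OF \<mu>0])
  also have "\<dots> \<le> 1 / 3"
  proof -
    have "ES m (\<lambda>X. (U_stat m X - \<mu>)\<^sup>2) \<le>
       2 * M ^ 3 * (4 * ?s / \<eta>\<^sup>2) + M\<^sup>2 * (4 * (real n)\<^sup>2 / \<eta>\<^sup>2 + 4 * ?s / \<eta>\<^sup>2)"
      using U_stat_variance[of m] by (simp add: \<mu>_def M_def)
    also have "\<dots> = M\<^sup>2 * (8 * (M * ?s) + 4 * (real n)\<^sup>2 + 4 * ?s) / \<eta>\<^sup>2"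
      by (simp add: add_divide_distrib distrib_left power2_eq_square power3_eq_cube)
    also have "\<dots> \<le> M\<^sup>2 * ((M * ?s)\<^sup>2 / 200)"
    proof -
      define w where "w = M * ?s"
      have w: "4000 * real n \<le> \<eta>\<^sup>2 * w" "4000 * real n \<le> w" "0 < w"
        using Ms Ms' Ms_pos by (auto simp: w_def)
      have "?s \<le> w" using M2 s0 by (simp add: w_def)
      have "(real n)\<^sup>2 \<le> real n * w"
        using w(2) n1 by (simp add: power2_eq_square)
      have nw: "w \<le> real n * w" using mult_right_mono[OF n1, of w] w(3) by (simp only: mult_1 less_imp_le)
      \<comment> \<open>Every summand is at most a multiple of \<open>n * w\<close>, with 16 in
        total, and 4000 = 16 * 250. Relaxing 250 to 200 is affordable, as 16/200 is still below
        1/12.\<close>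
      have "8 * w + 4 * (real n)\<^sup>2 + 4 * ?s \<le> 8 * (real n * w) + 4 * (real n * w) + 4 * (real n * w)"
        using \<open>?s \<le> w\<close> \<open>(real n)\<^sup>2 \<le> real n * w\<close> nw by linarith
      also have "\<dots> = (4000 * real n) * (w / 250)" by simp
      also have "\<dots> \<le> (\<eta>\<^sup>2 * w) * (w / 250)" using w by (intro mult_right_mono) auto
      also have "\<dots> = \<eta>\<^sup>2 * (w\<^sup>2 / 250)" by (simp add: power2_eq_square)
      also have "\<dots> \<le> \<eta>\<^sup>2 * (w\<^sup>2 / 200)" by (intro mult_left_mono) auto
      finally have "(8 * w + 4 * (real n)\<^sup>2 + 4 * ?s) / \<eta>\<^sup>2 \<le> w\<^sup>2 / 200"
        using eta1 by (simp add: field_simps)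
      hence "M\<^sup>2 * ((8 * w + 4 * (real n)\<^sup>2 + 4 * ?s) / \<eta>\<^sup>2) \<le> M\<^sup>2 * (w\<^sup>2 / 200)"
        by (intro mult_left_mono) auto
      thus ?thesis by (simp add: w_def)
    qed
    also have "\<dots> = 16 / 200 * (M * (M * ?s) / 4)\<^sup>2" by (simp add: power_mult_distrib power_divide)
    also have "\<dots> \<le> 16 / 200 * \<mu>\<^sup>2"
      using \<mu> M0 s0 by (intro mult_left_mono power_mono) auto
    also have "\<dots> \<le> 1 / 3 * (\<mu> / 2)\<^sup>2" by (simp add: power_divide)
    finally show ?thesis using \<mu>0 by (subst pos_divide_le_eq) auto
  qed
  finally show "measure_pmf.prob (samples m) {X. (0 < statistic n m X) \<noteq> (Far = Far)} \<le> 1 / 3" .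
qed

end

text \<open>For \<tau> of at least 1 the first power dominates the cube, and for \<tau> up to 3/2
  the second one does.\<close>

lemma sample_rate_ge:
  assumes "1 \<le> n"
  shows "real n ^ 3 * (\<beta>\<^sup>2 / \<epsilon>\<^sup>2) \<le> sample_rate n \<beta> \<epsilon>"
proof -
  have n1: "1 \<le> real n" using assms by simp
  have cube: "real n powr 3 = real n ^ 3" using n1 by simp
  have "real n ^ 3 \<le> (INF \<tau>\<in>{0<..}. real n powr (2 + \<tau>) + real n powr (6 - 2 * \<tau>))"
  proof (rule cINF_greatest)
    fix \<tau> :: real
    have "real n powr 3 \<le> real n powr (2 + \<tau>) \<or> real n powr 3 \<le> real n powr (6 - 2 * \<tau>)"
      using n1 powr_mono[of 3 "2 + \<tau>" "real n"] powr_mono[of 3 "6 - 2 * \<tau>" "real n"] by linarith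
    thus "real n ^ 3 \<le> real n powr (2 + \<tau>) + real n powr (6 - 2 * \<tau>)"
      unfolding cube[symmetric] by (smt (verit) powr_ge_zero)
  qed auto
  thus ?thesis unfolding sample_rate_def by (intro mult_right_mono) auto
qed

theorem theorem8:
  fixes \<eta> :: real
  assumes "0 < \<eta>"
  shows "\<exists>(c :: prog) (C :: real) (k :: nat). 0 < C \<and> polynomial_time c \<and>
    (\<forall>(n :: nat) (\<beta> :: real) (\<epsilon> :: real) (\<theta> :: nat \<Rightarrow> nat \<Rightarrow> real).
       1 \<le> n \<longrightarrow> 0 \<le> \<beta> \<longrightarrow> 0 < \<epsilon> \<longrightarrow>
       (\<forall>u<n. \<forall>v<n. \<theta> u v = \<theta> v u) \<longrightarrow>
       (\<forall>u<n. \<forall>v<n. u \<noteq> v \<longrightarrow> \<bar>\<theta> u v\<bar> \<le> \<beta>) \<longrightarrow>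
       high_temperature n \<eta> \<theta> \<longrightarrow>
       (let p = ising_pmf n (\<lambda>_. 0) \<theta>;
            m = soft_O_size C k (sample_rate n \<beta> \<epsilon>)
        in (p \<in> product_pmfs n \<longrightarrow> answer_prob c n m \<beta> \<epsilon> p Product \<ge> 2 / 3) \<and>
           (skl_dist p (product_pmfs n) \<ge> ereal \<epsilon> \<longrightarrow> answer_prob c n m \<beta> \<epsilon> p Far \<ge> 2 / 3)))"
\<comment> \<open>1000 is the 4000 of \<open>answer_prob_far\<close> divided by the 4 of
  \<open>far_corr_norm\<close>; exponent 0 means that no logarithmic factor is spent.\<close>
proof (rule exI[of _ tester], rule exI[of _ "1000 / \<eta>\<^sup>2"], rule exI[of _ 0], unfold Let_def,
    intro conjI allI impI)
  show "0 < 1000 / \<eta>\<^sup>2" using assms by simp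
  show "polynomial_time tester" by (rule polynomial_time_tester)
next
  fix n :: nat and \<beta> \<epsilon> :: real and \<theta> :: "nat \<Rightarrow> nat \<Rightarrow> real"
  assume n: "1 \<le> n" and "ising_pmf n (\<lambda>_. 0) \<theta> \<in> product_pmfs n"
  hence p: "ising_pmf n (\<lambda>_. 0) \<theta> = ising_pmf n (\<lambda>_. 0) (\<lambda>_ _. 0)" by (intro product_ising_uniform)
  \<comment> \<open>The uniform measure is treated with its own constant 1, since the threshold is
    calibrated for it.\<close>
  interpret U: ising n "\<lambda>_ _. 0" 1 by (rule ising_uniform) (use n in simp)
  show "answer_prob tester n (soft_O_size (1000 / \<eta>\<^sup>2) 0 (sample_rate n \<beta> \<epsilon>)) \<beta> \<epsilon> (ising_pmf n (\<lambda>_. 0) \<theta>) Product \<ge> 2 / 3"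
    unfolding p by (rule U.answer_prob_product) (use corr_norm_uniform n in auto)
next
  fix n :: nat and \<beta> \<epsilon> :: real and \<theta> :: "nat \<Rightarrow> nat \<Rightarrow> real"
  assume n: "1 \<le> n" and \<epsilon>: "0 < \<epsilon>" and sym: "\<forall>u<n. \<forall>v<n. \<theta> u v = \<theta> v u"
    and \<beta>: "\<forall>u<n. \<forall>v<n. u \<noteq> v \<longrightarrow> \<bar>\<theta> u v\<bar> \<le> \<beta>" and ht: "high_temperature n \<eta> \<theta>"
    and far: "ereal \<epsilon> \<le> skl_dist (ising_pmf n (\<lambda>_. 0) \<theta>) (product_pmfs n)"
  interpret ising n \<theta> \<eta> by standard (use n assms sym ht in auto)
  let ?m = "soft_O_size (1000 / \<eta>\<^sup>2) 0 (sample_rate n \<beta> \<epsilon>)"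
  have c: "4 * \<epsilon>\<^sup>2 \<le> \<beta>\<^sup>2 * (real n)\<^sup>2 * corr_norm"
    using far \<epsilon> \<beta> by (intro far_corr_norm) auto
  have "4000 / \<eta>\<^sup>2 * real n = 1000 / \<eta>\<^sup>2 * (real n * (4 * \<epsilon>\<^sup>2) / \<epsilon>\<^sup>2)" using \<epsilon> by simp
  also have "\<dots> \<le> 1000 / \<eta>\<^sup>2 * (real n * (\<beta>\<^sup>2 * (real n)\<^sup>2 * corr_norm) / \<epsilon>\<^sup>2)"
    using c by (intro mult_left_mono divide_right_mono) auto
  also have "\<dots> = 1000 / \<eta>\<^sup>2 * (real n ^ 3 * (\<beta>\<^sup>2 / \<epsilon>\<^sup>2)) * corr_norm"
    by (simp add: power2_eq_square power3_eq_cube)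
  also have "\<dots> \<le> 1000 / \<eta>\<^sup>2 * sample_rate n \<beta> \<epsilon> * corr_norm"
    using n corr_norm_nonneg by (intro mult_right_mono mult_left_mono sample_rate_ge) auto
  also have "\<dots> \<le> real ?m * corr_norm"
    using corr_norm_nonneg by (intro mult_right_mono) (auto simp: soft_O_size_def intro: real_nat_ceiling_ge)
  finally show "answer_prob tester n ?m \<beta> \<epsilon> (ising_pmf n (\<lambda>_. 0) \<theta>) Far \<ge> 2 / 3"
    by (rule answer_prob_far)
qed

end
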